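(* Let $k$ be an algebraically closed field of characteristic $p\geq 5$. The algebraic group $H=A_1$ has exactly $3$ orbits on singular $1$-spaces in the $5$-dimensional irreducible orthogonal module $V=V_{A_1}(4\lambda_1)$. The generic stabilizer is the finite group $Alt_4$.
   Context: $\lambda_1$ is the fundamental dominant weight of $A_1$, and $V_{A_1}(4\lambda_1)$ is the irreducible module of highest weight $4\lambda_1$, i.e. $S^4(W)$, the fourth symmetric power of the natural $2$-dimensional module $W$. It carries a non-degenerate $H$-invariant quadratic form (inherited from the symplectic form on $W$ by $(v_1\otimes\cdots\otimes v_4,u_1\otimes\cdots\otimes u_4)=\prod_i (v_i,u_i)$ on symmetric tensors). A singular $1$-space is $\langle v\rangle$ with $v\ne0$ singular for this form. The group $H$ is taken to be $PGL_2(k)$ (acting on $1$-spaces of $V$). The generic stabilizer is the stabilizer in $H$ of a point in the dense orbit on the variety of singular $1$-spaces. *)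

theory Defs
  imports
    "HOL-Analysis.Analysis"
    "HOL-Computational_Algebra.Polynomial"
    "HOL-Algebra.Group_Action"
    "HOL-Algebra.Sym_Groups"
begin

unbundle no fps_syntax

text \<open>
  The natural module \<open>W\<close> is \<open>'k ^ 2\<close>, and an element of its fourth tensor power is
  given by its coordinates with respect to the basis of pure tensors
  \<open>e (i 1) \<otimes> e (i 2) \<otimes> e (i 3) \<otimes> e (i 4)\<close>, so the coordinates are indexed by \<open>i :: 4 \<Rightarrow> 2\<close>.
\<close>

type_synonym 'k tensor4 = "'k ^ (4 \<Rightarrow> 2)"

definition pure_tensor :: "(4 \<Rightarrow> 'k::comm_ring_1 ^ 2) \<Rightarrow> 'k tensor4" where
  "pure_tensor v = (\<chi> i. \<Prod>l\<in>UNIV. v l $ i l)"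

definition symplectic_form :: "'k::comm_ring_1 ^ 2 \<Rightarrow> 'k ^ 2 \<Rightarrow> 'k" where
  "symplectic_form v u = v $ 1 * u $ 2 - v $ 2 * u $ 1"

text \<open>The bilinear extension of the product formula on pure tensors
  (see \<open>tensor_form_pure\<close> below).\<close>

definition tensor_form :: "'k::comm_ring_1 tensor4 \<Rightarrow> 'k tensor4 \<Rightarrow> 'k" where
  "tensor_form s t =
     (\<Sum>i\<in>UNIV. \<Sum>j\<in>UNIV. s $ i * t $ j *
        (\<Prod>l\<in>UNIV. symplectic_form (axis (i l) 1) (axis (j l) 1)))"

text \<open>The action of a matrix on the fourth tensor power, \<open>A \<otimes> A \<otimes> A \<otimes> A\<close>
  (see \<open>tensor_map_pure\<close> below).\<close>

definition tensor_map :: "'k::comm_ring_1 ^ 2 ^ 2 \<Rightarrow> 'k tensor4 \<Rightarrow> 'k tensor4" where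
  "tensor_map A t = (\<chi> i. \<Sum>j\<in>UNIV. (\<Prod>l\<in>UNIV. A $ i l $ j l) * t $ j)"

text \<open>The module \<open>S\<^sup>4(W)\<close>, realised by symmetric tensors. (In characteristic different from
  2 and 3 this agrees with the quotient realisation of the symmetric power.)\<close>

definition sym_tensors :: "'k::comm_ring_1 tensor4 set" where
  "sym_tensors = {t. \<forall>\<pi> i. bij \<pi> \<longrightarrow> t $ (i \<circ> \<pi>) = t $ i}"

definition quad_form :: "'k::comm_ring_1 tensor4 \<Rightarrow> 'k" where
  "quad_form t = tensor_form t t"

definition one_spaces :: "'k::field tensor4 set set" where
  "one_spaces = {vec.span {v} | v. v \<in> sym_tensors \<and> v \<noteq> 0}"

definition singular_one_spaces :: "'k::field tensor4 set set" where
  "singular_one_spaces = {vec.span {v} | v. v \<in> sym_tensors \<and> v \<noteq> 0 \<and> quad_form v = 0}"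

definition GL2 :: "('k::field ^ 2 ^ 2) monoid" where
  "GL2 = \<lparr>carrier = {A. invertible A}, mult = (**), one = mat 1\<rparr>"

definition scalar_matrices :: "('k::field ^ 2 ^ 2) set" where
  "scalar_matrices = {mat c | c. c \<noteq> 0}"

definition PGL2 :: "('k::field ^ 2 ^ 2) set monoid" where
  "PGL2 = GL2 Mod scalar_matrices"

text \<open>Elements of \<^term>\<open>PGL2\<close> are cosets of matrices. All matrices in a coset have the same
  effect on a 1-space, so the set of all products is again a 1-space
  (see \<open>PGL2_act_coset\<close> and \<open>PGL2_group_action\<close> below). The restriction
  is what \<^locale>\<open>group_action\<close> demands.\<close>

definition PGL2_act :: "('k::field ^ 2 ^ 2) set \<Rightarrow> 'k tensor4 set \<Rightarrow> 'k tensor4 set" where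
  "PGL2_act C = (\<lambda>L\<in>singular_one_spaces. {tensor_map A t | A t. A \<in> C \<and> t \<in> L})"

text \<open>\<open>homogeneous_poly d f\<close>: the function \<open>f\<close> is given by a homogeneous polynomial of degree
  \<open>d\<close> in the coordinates. The homogeneous polynomial functions on \<^term>\<open>sym_tensors\<close> are the
  restrictions of these.\<close>

inductive homogeneous_poly :: "nat \<Rightarrow> ('k::comm_ring_1 tensor4 \<Rightarrow> 'k) \<Rightarrow> bool" where
  const: "homogeneous_poly 0 (\<lambda>t. c)"
| coord: "homogeneous_poly 1 (\<lambda>t. t $ i)"
| add: "homogeneous_poly d f \<Longrightarrow> homogeneous_poly d g \<Longrightarrow> homogeneous_poly d (\<lambda>t. f t + g t)"
| mult: "homogeneous_poly d f \<Longrightarrow> homogeneous_poly e g \<Longrightarrow>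
           homogeneous_poly (d + e) (\<lambda>t. f t * g t)"

text \<open>The Zariski topology on the projective space of \<^term>\<open>sym_tensors\<close>, generated by the
  complements of hypersurfaces, and the induced topology on the quadric of singular 1-spaces.\<close>

definition zariski_topology :: "'k::field tensor4 set topology" where
  "zariski_topology = topology_generated_by
     {{L \<in> one_spaces. \<exists>t\<in>L. f t \<noteq> 0} | f. \<exists>d. homogeneous_poly d f}"

definition singular_variety :: "'k::field tensor4 set topology" where
  "singular_variety = subtopology zariski_topology singular_one_spaces"

definition is_dense_orbit :: "'k::field tensor4 set set \<Rightarrow> bool" where
  "is_dense_orbit \<Omega> \<longleftrightarrow>
     \<Omega> \<in> orbits PGL2 singular_one_spaces PGL2_act \<and>
     singular_variety closure_of \<Omega> = topspace singular_variety"


subsection \<open>Consistency of the definitions\<close>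

lemma prod_sum_fun:
  fixes f :: "4 \<Rightarrow> 2 \<Rightarrow> 'k::comm_ring_1"
  shows "(\<Prod>l\<in>UNIV. \<Sum>x\<in>UNIV. f l x) = (\<Sum>g\<in>UNIV. \<Prod>l\<in>UNIV. f l (g l))"
  by (subst prod_sum_PiE) auto

lemma prod_sum_fun2:
  fixes f :: "4 \<Rightarrow> 2 \<Rightarrow> 2 \<Rightarrow> 'k::comm_ring_1"
  shows "(\<Prod>l\<in>UNIV. \<Sum>x\<in>UNIV. \<Sum>y\<in>UNIV. f l x y) =
         (\<Sum>g\<in>UNIV. \<Sum>h\<in>UNIV. \<Prod>l\<in>UNIV. f l (g l) (h l))"
  by (simp add: prod_sum_fun)

lemma symplectic_form_sum:
  "symplectic_form v u =
     (\<Sum>x\<in>UNIV. \<Sum>y\<in>UNIV. v $ x * u $ y * symplectic_form (axis x 1) (axis y 1))"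
  by (simp add: symplectic_form_def sum_2 axis_def)

lemma tensor_form_pure:
  "tensor_form (pure_tensor v) (pure_tensor u) = (\<Prod>l\<in>UNIV. symplectic_form (v l) (u l))"
  by (subst symplectic_form_sum)
    (simp add: prod_sum_fun2 tensor_form_def pure_tensor_def prod.distrib)

lemma tensor_map_pure:
  "tensor_map A (pure_tensor v) = pure_tensor (\<lambda>l. A *v v l)"
  by (simp add: vec_eq_iff tensor_map_def pure_tensor_def matrix_vector_mult_def
      prod_sum_fun prod.distrib)

lemma tensor_map_mult: "tensor_map (A ** B) t = tensor_map A (tensor_map B t)"
proof -
  have "(\<Sum>j\<in>UNIV. (\<Prod>l\<in>UNIV. \<Sum>x\<in>UNIV. A $ i l $ x * B $ x $ j l) * t $ j) =
        (\<Sum>m\<in>UNIV. (\<Prod>l\<in>UNIV. A $ i l $ m l) * (\<Sum>j\<in>UNIV. (\<Prod>l\<in>UNIV. B $ m l $ j l) * t $ j))"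
    for i
    unfolding prod_sum_fun prod.distrib sum_distrib_left sum_distrib_right
    by (subst sum.swap) (simp add: mult.assoc)
  then show ?thesis
    by (simp add: vec_eq_iff tensor_map_def matrix_matrix_mult_def)
qed

lemma tensor_map_mat: "tensor_map (mat c) t = c ^ 4 *s t"
proof -
  have "(\<Prod>l\<in>UNIV. (mat c :: 'a^2^2) $ i l $ j l) = (if i = j then c ^ 4 else 0)" for i j :: "4 \<Rightarrow> 2"
  proof (cases "i = j")
    case True
    then show ?thesis by (simp add: mat_def)
  next
    case False
    then obtain l where "i l \<noteq> j l" by auto
    then have "(\<Prod>l\<in>UNIV. (mat c :: 'a^2^2) $ i l $ j l) = 0"
      by (intro prod_zero) (auto simp: mat_def)
    with False show ?thesis by simp
  qed
  then show ?thesis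
    by (simp add: vec_eq_iff tensor_map_def if_distrib[of "\<lambda>x. x * _"] sum.delta cong: if_cong)
qed

lemma tensor_map_scale: "tensor_map A (c *s t) = c *s tensor_map A t"
  by (simp add: vec_eq_iff tensor_map_def sum_distrib_left algebra_simps)

lemma tensor_map_add: "tensor_map A (s + t) = tensor_map A s + tensor_map A t"
  by (simp add: vec_eq_iff tensor_map_def sum.distrib algebra_simps)

lemma tensor_form_map:
  "tensor_form (tensor_map A s) (tensor_map A t) = det A ^ 4 * tensor_form s t"
proof -
  let ?w = "\<lambda>x y. symplectic_form (axis x 1) (axis y (1::'a))"
  have det: "(\<Sum>x\<in>UNIV. \<Sum>y\<in>UNIV. A $ x $ a * A $ y $ b * ?w x y) = det A * ?w a b"
    for a b :: 2
    using exhaust_2[of a] exhaust_2[of b]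
    by (auto simp: symplectic_form_def sum_2 axis_def det_2 algebra_simps)
  have "tensor_form (tensor_map A s) (tensor_map A t) =
     (\<Sum>i\<in>UNIV. \<Sum>j\<in>UNIV. \<Sum>a\<in>UNIV. \<Sum>b\<in>UNIV. s $ a * t $ b *
        (\<Prod>l\<in>UNIV. A $ i l $ a l * A $ j l $ b l * ?w (i l) (j l)))"
    unfolding tensor_form_def tensor_map_def vec_lambda_beta sum_product sum_distrib_right
      prod.distrib
    unfolding sum_distrib_left sum_distrib_right
    by (intro sum.cong refl) (simp only: mult_ac)
  also have "\<dots> = (\<Sum>i\<in>UNIV. \<Sum>a\<in>UNIV. \<Sum>b\<in>UNIV. \<Sum>j\<in>UNIV. s $ a * t $ b *
        (\<Prod>l\<in>UNIV. A $ i l $ a l * A $ j l $ b l * ?w (i l) (j l)))"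
    apply (rule sum.cong[OF refl])
    apply (rule trans[OF sum.swap])
    apply (rule sum.cong[OF refl])
    apply (rule sum.swap)
    done
  also have "\<dots> = (\<Sum>a\<in>UNIV. \<Sum>b\<in>UNIV. \<Sum>i\<in>UNIV. \<Sum>j\<in>UNIV. s $ a * t $ b *
        (\<Prod>l\<in>UNIV. A $ i l $ a l * A $ j l $ b l * ?w (i l) (j l)))"
    apply (rule trans[OF sum.swap])
    apply (rule sum.cong[OF refl])
    apply (rule sum.swap)
    done
  also have "\<dots> = (\<Sum>a\<in>UNIV. \<Sum>b\<in>UNIV. s $ a * t $ b *
        (\<Prod>l\<in>UNIV. \<Sum>x\<in>UNIV. \<Sum>y\<in>UNIV. A $ x $ a l * A $ y $ b l * ?w x y))"
    unfolding prod_sum_fun2 sum_distrib_left ..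
  also have "\<dots> = det A ^ 4 * tensor_form s t"
    unfolding det by (simp add: prod.distrib tensor_form_def sum_distrib_left mult_ac)
  finally show ?thesis .
qed

lemma tensor_map_sym:
  assumes "t \<in> sym_tensors"
  shows "tensor_map A t \<in> sym_tensors"
  unfolding sym_tensors_def
proof (safe)
  fix \<pi> :: "4 \<Rightarrow> 4" and i :: "4 \<Rightarrow> 2"
  assume \<pi>: "bij \<pi>"
  have bij: "bij (\<lambda>j :: 4 \<Rightarrow> 2. j \<circ> \<pi>)"
  proof (rule o_bij[where g = "\<lambda>j. j \<circ> inv_into UNIV \<pi>"])
    show "(\<lambda>j :: 4 \<Rightarrow> 2. j \<circ> inv_into UNIV \<pi>) \<circ> (\<lambda>j. j \<circ> \<pi>) = id"
      using \<pi> by (simp add: fun_eq_iff bij_is_surj surj_f_inv_f)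
    show "(\<lambda>j :: 4 \<Rightarrow> 2. j \<circ> \<pi>) \<circ> (\<lambda>j. j \<circ> inv_into UNIV \<pi>) = id"
      using \<pi> by (simp add: fun_eq_iff bij_is_inj inv_f_f)
  qed
  have "tensor_map A t $ (i \<circ> \<pi>) = (\<Sum>j\<in>UNIV. (\<Prod>l\<in>UNIV. A $ i (\<pi> l) $ j l) * t $ j)"
    by (simp add: tensor_map_def)
  also have "\<dots> = (\<Sum>j\<in>UNIV. (\<Prod>l\<in>UNIV. A $ i (\<pi> l) $ j (\<pi> l)) * t $ (j \<circ> \<pi>))"
    by (subst sum.reindex_bij_betw[OF bij, symmetric]) simp
  also have "\<dots> = (\<Sum>j\<in>UNIV. (\<Prod>l\<in>UNIV. A $ i l $ j l) * t $ j)"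
  proof (rule sum.cong[OF refl])
    fix j :: "4 \<Rightarrow> 2"
    have "(\<Prod>l\<in>UNIV. A $ i (\<pi> l) $ j (\<pi> l)) = (\<Prod>l\<in>UNIV. A $ i l $ j l)"
      by (rule prod.reindex_bij_betw[OF \<pi>])
    moreover have "t $ (j \<circ> \<pi>) = t $ j"
      using assms \<pi> by (simp add: sym_tensors_def)
    ultimately show "(\<Prod>l\<in>UNIV. A $ i (\<pi> l) $ j (\<pi> l)) * t $ (j \<circ> \<pi>) =
        (\<Prod>l\<in>UNIV. A $ i l $ j l) * t $ j" by simp
  qed
  finally show "tensor_map A t $ (i \<circ> \<pi>) = tensor_map A t $ i"
    by (simp add: tensor_map_def)
qed

lemma tensor_map_span: "tensor_map A ` vec.span {v} = vec.span {tensor_map A v}"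
  by (auto simp: vec.span_singleton tensor_map_scale image_iff)

lemma tensor_map_eq_0_iff:
  fixes A :: "'k::field ^ 2 ^ 2"
  assumes "invertible A"
  shows "tensor_map A t = 0 \<longleftrightarrow> t = 0"
proof
  obtain B where "B ** A = mat 1" using assms by (auto simp: invertible_def)
  then have "tensor_map B (tensor_map A t) = t"
    by (simp flip: tensor_map_mult add: tensor_map_mat)
  then show "t = 0" if "tensor_map A t = 0"
    using that tensor_map_scale[of B 0 0] by simp
  show "tensor_map A t = 0" if "t = 0" using that tensor_map_scale[of A 0 0] by simp
qed

lemma tensor_map_singular:
  assumes "invertible A" "L \<in> singular_one_spaces"
  shows "tensor_map A ` L \<in> singular_one_spaces"
proof -
  obtain v where v: "L = vec.span {v}" "v \<in> sym_tensors" "v \<noteq> 0" "quad_form v = 0"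
    using assms(2) by (auto simp: singular_one_spaces_def)
  then have "tensor_map A v \<in> sym_tensors" "tensor_map A v \<noteq> 0" "quad_form (tensor_map A v) = 0"
    using assms(1) by (simp_all add: tensor_map_sym tensor_map_eq_0_iff quad_form_def tensor_form_map)
  then show ?thesis
    unfolding v(1) tensor_map_span singular_one_spaces_def by blast
qed

lemma mat_mult_mat: "(mat a :: 'k::field^2^2) ** mat b = mat (a * b)"
  by (simp add: vec_eq_iff matrix_matrix_mult_def mat_def sum_2 forall_2)

lemma mat_comm: "mat a ** A = A ** mat a" for A :: "'k::field ^ 2 ^ 2"
proof -
  have "(\<Sum>k\<in>UNIV. (if i = k then a else 0) * A $ k $ j) =
        (\<Sum>k\<in>UNIV. A $ i $ k * (if k = j then a else 0))" for i j :: 2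
    using exhaust_2[of i] exhaust_2[of j] by (auto simp: sum_2 mult.commute)
  then show ?thesis by (simp add: vec_eq_iff matrix_matrix_mult_def mat_def)
qed

lemma invertible_mat:
  assumes "a \<noteq> 0" shows "invertible (mat a :: 'k::field^2^2)"
  unfolding invertible_def
  by (rule exI[of _ "mat (inverse a)"]) (use assms in \<open>simp add: mat_mult_mat\<close>)

lemma GL2_group: "group (GL2 :: ('k::field ^ 2 ^ 2) monoid)"
proof (rule groupI)
  fix A :: "'k ^ 2 ^ 2" assume "A \<in> carrier GL2"
  then obtain B where B: "A ** B = mat 1" "B ** A = mat 1" by (auto simp: GL2_def invertible_def)
  then have "invertible B" by (auto simp: invertible_def)
  with B show "\<exists>B\<in>carrier GL2. B \<otimes>\<^bsub>GL2\<^esub> A = \<one>\<^bsub>GL2\<^esub>"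
    by (auto simp: GL2_def)
qed (auto simp: GL2_def invertible_mult matrix_mul_assoc invertible_mat)

lemma GL2_simps: "carrier GL2 = {A. invertible A}" "A \<otimes>\<^bsub>GL2\<^esub> B = A ** B" "\<one>\<^bsub>GL2\<^esub> = mat 1"
  by (simp_all add: GL2_def)

lemma scalar_matrices_normal: "scalar_matrices \<lhd> (GL2 :: ('k::field ^ 2 ^ 2) monoid)"
proof -
  interpret group "GL2 :: ('k ^ 2 ^ 2) monoid" by (rule GL2_group)
  have sub: "subgroup scalar_matrices (GL2 :: ('k ^ 2 ^ 2) monoid)"
  proof (rule subgroupI)
    show "scalar_matrices \<subseteq> carrier (GL2 :: ('k ^ 2 ^ 2) monoid)"
      by (auto simp: scalar_matrices_def GL2_simps invertible_mat)
    show "scalar_matrices \<noteq> ({} :: ('k ^ 2 ^ 2) set)"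
      by (auto simp: scalar_matrices_def intro: exI[of _ "1 :: 'k"])
  next
    fix A :: "'k ^ 2 ^ 2" assume "A \<in> scalar_matrices"
    then obtain a where a: "A = mat a" "a \<noteq> 0" by (auto simp: scalar_matrices_def)
    have "inv\<^bsub>GL2\<^esub> A = mat (inverse a)"
      by (rule inv_equality) (use a in \<open>auto simp: GL2_simps mat_mult_mat invertible_mat\<close>)
    with a show "inv\<^bsub>GL2\<^esub> A \<in> scalar_matrices"
      unfolding scalar_matrices_def using nonzero_imp_inverse_nonzero by blast
  next
    fix A B :: "'k ^ 2 ^ 2" assume "A \<in> scalar_matrices" "B \<in> scalar_matrices"
    then show "A \<otimes>\<^bsub>GL2\<^esub> B \<in> scalar_matrices"
      by (auto simp: scalar_matrices_def GL2_simps mat_mult_mat) 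
  qed
  show ?thesis
  proof (rule normalI[OF sub], rule ballI)
    fix A :: "'k ^ 2 ^ 2"
    show "scalar_matrices #>\<^bsub>GL2\<^esub> A = A <#\<^bsub>GL2\<^esub> scalar_matrices"
      unfolding r_coset_def l_coset_def GL2_simps scalar_matrices_def by (auto simp: mat_comm)
  qed
qed

lemma PGL2_group: "group PGL2"
  unfolding PGL2_def by (rule normal.factorgroup_is_group[OF scalar_matrices_normal])

lemma span_scale_image:
  assumes "(c::'k::field) \<noteq> 0"
  shows "(*s) c ` vec.span {v} = vec.span {v}"
proof
  show "(*s) c ` vec.span {v} \<subseteq> vec.span {v}"
    by (auto intro: vec.span_scale)
  show "vec.span {v} \<subseteq> (*s) c ` vec.span {v}"
  proof
    fix x assume "x \<in> vec.span {v}"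
    then have "inverse c *s x \<in> vec.span {v}" by (rule vec.span_scale)
    moreover have "x = c *s (inverse c *s x)" using assms by simp
    ultimately show "x \<in> (*s) c ` vec.span {v}" by (rule rev_image_eqI)
  qed
qed

lemma PGL2_act_coset:
  fixes A :: "'k::field ^ 2 ^ 2"
  assumes "L \<in> singular_one_spaces"
  shows "PGL2_act (scalar_matrices #>\<^bsub>GL2\<^esub> A) L = tensor_map A ` L"
proof -
  obtain v where v: "L = vec.span {v}" using assms by (auto simp: singular_one_spaces_def)
  have "PGL2_act (scalar_matrices #>\<^bsub>GL2\<^esub> A) L =
      (\<Union>c\<in>-{0}. tensor_map (mat c ** A) ` L)"
    using assms by (auto simp: PGL2_act_def r_coset_def GL2_simps scalar_matrices_def)
  moreover have "tensor_map (mat c ** A) ` L = tensor_map A ` L" if "c \<in> -{0}" for c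
    using that span_scale_image[of "c ^ 4" "tensor_map A v"]
    by (simp add: v tensor_map_mult tensor_map_mat tensor_map_span flip: image_image)
  moreover have "-{0} \<noteq> ({} :: 'k set)" using one_neq_zero[where 'a = 'k] by blast
  ultimately show ?thesis by simp
qed

lemma PGL2_group_action:
  "group_action (PGL2 :: ('k::field ^ 2 ^ 2) set monoid) singular_one_spaces PGL2_act"
proof -
  let ?G = "PGL2 :: ('k ^ 2 ^ 2) set monoid"
  let ?E = "singular_one_spaces :: 'k tensor4 set set"
  interpret N: normal scalar_matrices "GL2 :: ('k ^ 2 ^ 2) monoid"
    by (rule scalar_matrices_normal)
  have car: "\<exists>A. invertible A \<and> C = scalar_matrices #>\<^bsub>GL2\<^esub> A" if "C \<in> carrier ?G" for C
    using that by (auto simp: PGL2_def FactGroup_def RCOSETS_def GL2_simps)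
  have bij: "PGL2_act C \<in> Bij ?E" if C: "C \<in> carrier ?G" for C
  proof -
    obtain A where A: "invertible A" "C = scalar_matrices #>\<^bsub>GL2\<^esub> A" using car[OF C] by blast
    obtain B where B: "A ** B = mat 1" "B ** A = mat 1" using A by (auto simp: invertible_def)
    then have iB: "invertible B" by (auto simp: invertible_def)
    have "bij_betw ((`) (tensor_map A)) ?E ?E"
      by (rule bij_betw_byWitness[where f' = "(`) (tensor_map B)"])
        (use A(1) iB in \<open>auto simp: image_image tensor_map_singular tensor_map_mat B
            simp flip: tensor_map_mult\<close>)
    then have "bij_betw (PGL2_act C) ?E ?E"
      by (rule bij_betw_cong[THEN iffD1, rotated]) (simp add: A PGL2_act_coset)
    then show ?thesis by (simp add: Bij_def PGL2_act_def)
  qed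
  have mult: "PGL2_act (C \<otimes>\<^bsub>?G\<^esub> D) = PGL2_act C \<otimes>\<^bsub>BijGroup ?E\<^esub> PGL2_act D"
    if C: "C \<in> carrier ?G" and D: "D \<in> carrier ?G" for C D
  proof -
    obtain A where A: "invertible A" "C = scalar_matrices #>\<^bsub>GL2\<^esub> A" using car[OF C] by blast
    obtain B where B: "invertible B" "D = scalar_matrices #>\<^bsub>GL2\<^esub> B" using car[OF D] by blast
    have "C \<otimes>\<^bsub>?G\<^esub> D = scalar_matrices #>\<^bsub>GL2\<^esub> (A ** B)"
      using N.rcos_sum[of A B] A B by (simp add: PGL2_def FactGroup_def GL2_simps)
    then have "PGL2_act (C \<otimes>\<^bsub>?G\<^esub> D) L = compose ?E (PGL2_act C) (PGL2_act D) L" if "L \<in> ?E" for L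
      using that A B by (simp add: PGL2_act_coset compose_def tensor_map_singular
          tensor_map_mult image_image)
    then have "PGL2_act (C \<otimes>\<^bsub>?G\<^esub> D) = compose ?E (PGL2_act C) (PGL2_act D)"
      by (intro extensionalityI[of _ ?E]) (auto simp: PGL2_act_def)
    then show ?thesis using bij[OF C] bij[OF D] by (simp add: BijGroup_def)
  qed
  show ?thesis
    unfolding group_action_def group_hom_def group_hom_axioms_def
    using PGL2_group group_BijGroup[of ?E] bij mult by (auto simp: hom_def BijGroup_def)
qed

end

theory Submission
  imports Defs
begin

text \<open>
  A symmetric tensor \<open>t\<close> is a binary quartic, and it is singular iff the invariant
  \<open>a0 a4 - 4 a1 a3 + 3 a2\<^sup>2\<close> vanishes. Move a root of the quartic to infinity, so that
  \<open>a4 = 0\<close>. If this root is multiple, the invariant forces it to be at least triple, which leaves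
  \<open>y\<^sup>4\<close> and \<open>x y\<^sup>3\<close>; if it is simple, a translation kills \<open>a2\<close>, hence also \<open>a1\<close>, which
  leaves \<open>x\<^sup>3 y\<close> and \<open>y (y\<^sup>3 - x\<^sup>3)\<close>. The catalecticant vanishes on quartics with a
  triple root but not on the last form, so no other orbit can be dense; the last orbit is dense since
  each degenerate form lies on a line in the quadric all of whose other points belong to it.

  The stabilizer of \<open>y (y\<^sup>3 - x\<^sup>3)\<close> permutes its four roots faithfully. It induces a
  3-cycle and a double transposition, which generate the alternating group, but not a transposition:
  a map fixing infinity and 1 and swapping the two other roots would give \<open>3 = 0\<close>.
\<close>

section \<open>Coordinates on symmetric tensors\<close>

text \<open>The complete invariant of an index function under permutation of the four tensor
  positions (\<open>twos_comp_bij\<close>, \<open>twos_eqD\<close>), so a symmetric tensor has one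
  coordinate per value.\<close>

definition twos :: "(4 \<Rightarrow> 2) \<Rightarrow> nat" where
  "twos i = (\<Sum>l\<in>UNIV. if i l = 2 then 1 else 0)"

text \<open>Symmetric tensors stand for binary quartics with binomial coefficients pulled out; the sign
  convention is that of \<open>quartic_bq\<close> below.\<close>

definition bq :: "'k \<Rightarrow> 'k \<Rightarrow> 'k \<Rightarrow> 'k \<Rightarrow> 'k \<Rightarrow> 'k tensor4" where
  "bq a0 a1 a2 a3 a4 = (\<chi> i. [a0, a1, a2, a3, a4] ! twos i)"

text \<open>Turns sums over \<open>4 \<Rightarrow> 2\<close> into fourfold sums over
  \<open>2\<close>, which \<open>sum_2\<close> expands completely.\<close>

definition index4 :: "2 \<Rightarrow> 2 \<Rightarrow> 2 \<Rightarrow> 2 \<Rightarrow> 4 \<Rightarrow> 2" where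
  "index4 x y z w = (\<lambda>l. if l = 1 then x else if l = 2 then y else if l = 3 then z else w)"

lemma index4_simps [simp]:
  "index4 x y z w 1 = x" "index4 x y z w 2 = y" "index4 x y z w 3 = z" "index4 x y z w 4 = w"
  by (simp_all add: index4_def)

lemma index4_collapse [simp]: "index4 (i 1) (i 2) (i 3) (i 4) = i"
  by (simp add: fun_eq_iff forall_4)

lemma prod_4: "prod f (UNIV :: 4 set) = f 1 * f 2 * f 3 * f 4"
  unfolding UNIV_4 by (simp add: ac_simps)

lemma sum_index4:
  "(\<Sum>i\<in>UNIV. F i) = (\<Sum>x\<in>UNIV. \<Sum>y\<in>UNIV. \<Sum>z\<in>UNIV. \<Sum>w\<in>UNIV. F (index4 x y z w))"
proof -
  have "bij_betw (\<lambda>(x, y, z, w). index4 x y z w) UNIV UNIV"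
    by (rule bij_betw_byWitness[where f' = "\<lambda>i. (i 1, i 2, i 3, i 4)"])
      auto
  from sum.reindex_bij_betw[OF this, of F, symmetric]
  have "(\<Sum>i\<in>UNIV. F i) = (\<Sum>(x, y, z, w)\<in>UNIV. F (index4 x y z w))"
    by (simp add: case_prod_beta)
  then show ?thesis
    by (simp add: sum.cartesian_product flip: UNIV_Times_UNIV)
qed

lemma twos_index4:
  "twos (index4 x y z w) = (if x = 2 then 1 else 0) + (if y = 2 then 1 else 0) +
     (if z = 2 then 1 else 0) + (if w = 2 then 1 else 0)"
  by (simp add: twos_def sum_4)

lemma twos_le: "twos i \<le> 4"
  by (subst index4_collapse[symmetric]) (simp add: twos_index4 del: index4_collapse)

lemma twos_cases: "twos i = 0 \<or> twos i = 1 \<or> twos i = 2 \<or> twos i = 3 \<or> twos i = 4"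
  using twos_le[of i] by linarith

lemma twos_reps:
  "twos (index4 1 1 1 1) = 0" "twos (index4 1 1 1 2) = 1" "twos (index4 1 1 2 2) = 2"
  "twos (index4 1 2 2 2) = 3" "twos (index4 2 2 2 2) = 4"
  by (simp_all add: twos_index4)

lemma twos_comp_bij:
  assumes "bij \<pi>"
  shows "twos (i \<circ> \<pi>) = twos i"
  using sum.reindex_bij_betw[OF assms, of "\<lambda>l. if i l = 2 then 1 else 0 :: nat"]
  by (simp add: twos_def)

text \<open>Equally many twos means equally many ones as well, so a bijection between the positions
  of the twos and one between the positions of the ones glue to a permutation.\<close>

lemma twos_eqD:
  assumes "twos i = twos j"
  obtains \<pi> where "bij \<pi>" "j = i \<circ> \<pi>"
proof -
  have card2: "card {l. i l = 2} = card {l. j l = 2}"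
    using assms by (simp add: twos_def flip: sum.inter_filter)
  have card1: "card {l. i l \<noteq> 2} = card {l. j l \<noteq> 2}"
    using card2 by (simp add: Collect_neg_eq Compl_eq_Diff_UNIV card_Diff_subset)
  obtain f where f: "bij_betw f {l. j l = 2} {l. i l = 2}"
    using finite_same_card_bij[OF _ _ card2[symmetric]] by auto
  obtain g where g: "bij_betw g {l. j l \<noteq> 2} {l. i l \<noteq> 2}"
    using finite_same_card_bij[OF _ _ card1[symmetric]] by auto
  let ?h = "\<lambda>l. if j l = 2 then f l else g l"
  have fg: "bij_betw ?h {l. j l = 2} {l. i l = 2}" "bij_betw ?h {l. j l \<noteq> 2} {l. i l \<noteq> 2}"
    using f g by (auto intro: bij_betw_cong[THEN iffD1, rotated])
  have "bij_betw ?h ({l. j l = 2} \<union> {l. j l \<noteq> 2}) ({l. i l = 2} \<union> {l. i l \<noteq> 2})"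
    by (rule bij_betw_combine[OF fg]) auto
  then have "bij ?h"
    by (simp flip: Collect_disj_eq)
  moreover have "j l = i (?h l)" for l
  proof (cases "j l = 2")
    case True
    then show ?thesis using bij_betw_apply[OF fg(1)] by force
  next
    case False
    then have "i (?h l) \<noteq> 2" using bij_betw_apply[OF fg(2)] by force
    with False show ?thesis using exhaust_2[of "j l"] exhaust_2[of "i (?h l)"] by auto
  qed
  ultimately show ?thesis using that[of ?h] by (auto simp: fun_eq_iff)
qed

lemma bq_sym: "bq a0 a1 a2 a3 a4 \<in> sym_tensors"
  by (simp add: sym_tensors_def bq_def twos_comp_bij)

lemma sym_tensor_bq:
  assumes "t \<in> sym_tensors"
  obtains a0 a1 a2 a3 a4 where "t = bq a0 a1 a2 a3 a4"
proof -
  have eq: "t $ i = t $ j" if "twos i = twos j" for i j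
    by (rule twos_eqD[OF that]) (use assms in \<open>simp add: sym_tensors_def\<close>)
  have "t = bq (t $ index4 1 1 1 1) (t $ index4 1 1 1 2) (t $ index4 1 1 2 2)
      (t $ index4 1 2 2 2) (t $ index4 2 2 2 2)" (is "t = ?b")
  proof (rule vec_eq_iff[THEN iffD2], rule allI)
    fix i
    consider "twos i = 0" | "twos i = 1" | "twos i = 2" | "twos i = 3" | "twos i = 4"
      using twos_cases[of i] by argo
    then show "t $ i = ?b $ i"
      by cases (simp_all add: bq_def, (rule eq, simp add: twos_reps)+)
  qed
  then show ?thesis by (rule that)
qed

lemma bq_coords:
  "bq a0 a1 a2 a3 a4 $ index4 1 1 1 1 = a0" "bq a0 a1 a2 a3 a4 $ index4 1 1 1 2 = a1"
  "bq a0 a1 a2 a3 a4 $ index4 1 1 2 2 = a2" "bq a0 a1 a2 a3 a4 $ index4 1 2 2 2 = a3"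
  "bq a0 a1 a2 a3 a4 $ index4 2 2 2 2 = a4"
  by (simp_all add: bq_def twos_reps)

lemma bq_eq_iff:
  "bq a0 a1 a2 a3 a4 = bq b0 b1 b2 b3 b4 \<longleftrightarrow> a0 = b0 \<and> a1 = b1 \<and> a2 = b2 \<and> a3 = b3 \<and> a4 = b4"
  by (auto simp: bq_coords dest: arg_cong[where f = "\<lambda>t. (t $ index4 1 1 1 1, t $ index4 1 1 1 2,
      t $ index4 1 1 2 2, t $ index4 1 2 2 2, t $ index4 2 2 2 2)"])

lemma bq_scale: "c *s bq a0 a1 a2 a3 a4 = bq (c * a0) (c * a1) (c * a2) (c * a3) (c * a4)"
  unfolding vec_eq_iff
proof
  fix i
  show "(c *s bq a0 a1 a2 a3 a4) $ i = bq (c * a0) (c * a1) (c * a2) (c * a3) (c * a4) $ i"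
    using twos_cases[of i] by (auto simp: bq_def)
qed

lemma bq_add:
  "bq a0 a1 a2 a3 a4 + bq b0 b1 b2 b3 b4 = bq (a0 + b0) (a1 + b1) (a2 + b2) (a3 + b3) (a4 + b4)"
  unfolding vec_eq_iff
proof
  fix i
  show "(bq a0 a1 a2 a3 a4 + bq b0 b1 b2 b3 b4) $ i =
      bq (a0 + b0) (a1 + b1) (a2 + b2) (a3 + b3) (a4 + b4) $ i"
    using twos_cases[of i] by (auto simp: bq_def)
qed

lemma bq_0: "bq 0 0 0 0 0 = (0 :: 'k::zero tensor4)"
  unfolding vec_eq_iff
proof
  fix i
  show "bq 0 0 0 0 0 $ i = (0 :: 'k tensor4) $ i"
    using twos_cases[of i] by (auto simp: bq_def)
qed

text \<open>Only pairs of index functions differing in all four positions contribute. If the first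
  has k twos, the sign is (-1)^k, and the binomial coefficient counts the choices of these
  positions.\<close>

lemma tensor_form_bq:
  fixes a0 :: "'k::comm_ring_1"
  shows "tensor_form (bq a0 a1 a2 a3 a4) (bq b0 b1 b2 b3 b4) =
     a0 * b4 - 4 * (a1 * b3) + 6 * (a2 * b2) - 4 * (a3 * b1) + a4 * b0"
proof -
  have w: "symplectic_form (axis 1 1) (axis 1 1) = (0::'k)"
    "symplectic_form (axis 1 1) (axis 2 1) = (1::'k)"
    "symplectic_form (axis 2 1) (axis 1 1) = (-1::'k)"
    "symplectic_form (axis 2 1) (axis 2 1) = (0::'k)"
    by (simp_all add: symplectic_form_def axis_def)
  have b: "bq c0 c1 c2 c3 c4 $ index4 x y z u = [c0, c1, c2, c3, c4] !
      ((if x = 2 then 1 else 0) + (if y = 2 then 1 else 0) +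
       (if z = 2 then 1 else 0) + (if u = 2 then 1 else 0))" for c0 c1 c2 c3 c4 :: 'k and x y z u
    by (simp add: bq_def twos_index4)
  show ?thesis
    unfolding tensor_form_def sum_index4 prod_4 index4_simps sum_2 w
      mult_zero_left mult_zero_right add_0_left add_0_right
    by (simp add: b)
qed


section \<open>Binary quartics\<close>

text \<open>Evaluating by pairing with \<open>w \<otimes> w \<otimes> w \<otimes> w\<close>, instead of treating the coordinates of a
  tensor as coefficients, makes the action on forms covariant (\<open>quartic_map\<close>): roots of \<open>t\<close> are
  mapped to roots of \<open>tensor_map A t\<close>.\<close>

definition quartic :: "'k::comm_ring_1 tensor4 \<Rightarrow> 'k ^ 2 \<Rightarrow> 'k" where
  "quartic t w = tensor_form t (pure_tensor (\<lambda>_. w))"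

definition matrix2 :: "'k::zero \<Rightarrow> 'k \<Rightarrow> 'k \<Rightarrow> 'k \<Rightarrow> 'k ^ 2 ^ 2" where
  "matrix2 a b c d = vector [vector [a, b], vector [c, d]]"

lemma pure_tensor_const:
  "pure_tensor (\<lambda>_. w) = bq (w $ 1 ^ 4) (w $ 1 ^ 3 * w $ 2) (w $ 1 ^ 2 * w $ 2 ^ 2)
     (w $ 1 * w $ 2 ^ 3) (w $ 2 ^ 4)" (is "_ = ?b")
proof -
  have "pure_tensor (\<lambda>_. w) $ index4 x y z u = ?b $ index4 x y z u" for x y z u
    using exhaust_2[of x] exhaust_2[of y] exhaust_2[of z] exhaust_2[of u]
    by (auto simp: bq_def pure_tensor_def prod_4 twos_index4 power2_eq_square power3_eq_cube
        power4_eq_xxxx mult_ac)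
  from this[of "i 1" "i 2" "i 3" "i 4" for i :: "4 \<Rightarrow> 2"] show ?thesis
    by (simp add: vec_eq_iff)
qed

lemma quartic_bq:
  "quartic (bq a0 a1 a2 a3 a4) w =
     a0 * w $ 2 ^ 4 - 4 * (a1 * (w $ 1 * w $ 2 ^ 3)) + 6 * (a2 * (w $ 1 ^ 2 * w $ 2 ^ 2))
     - 4 * (a3 * (w $ 1 ^ 3 * w $ 2)) + a4 * w $ 1 ^ 4"
  by (simp add: quartic_def pure_tensor_const tensor_form_bq)

text \<open>The bracket is the classical degree 2 invariant of a binary quartic; outside
  characteristic 2 it has the same zeros as the form.\<close>

lemma quad_form_bq:
  "quad_form (bq a0 a1 a2 a3 a4) = 2 * (a0 * a4 - 4 * (a1 * a3) + 3 * a2 ^ 2)"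
  by (simp add: quad_form_def tensor_form_bq algebra_simps power2_eq_square)

text \<open>Applying \<open>A\<close> to both arguments of the pairing costs
  \<open>det A ^ 4\<close>, and \<open>A\<close> maps the fourth tensor power of \<open>w\<close> to
  that of \<open>A *v w\<close>.\<close>

lemma quartic_map: "quartic (tensor_map A t) (A *v w) = det A ^ 4 * quartic t w"
  unfolding quartic_def by (simp flip: tensor_map_pure add: tensor_form_map)

lemma matrix2_mult_vec: "(matrix2 a b c d *v w) $ 1 = a * w $ 1 + b * w $ 2"
  "(matrix2 a b c d *v w) $ 2 = c * w $ 1 + d * w $ 2"
  by (simp_all add: matrix2_def matrix_vector_mult_def sum_2)

lemma det_matrix2: "det (matrix2 a b c d) = a * d - b * (c::'k::comm_ring_1)"
  by (simp add: matrix2_def det_2)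

lemma invertible_matrix2:
  "invertible (matrix2 a b c d) \<longleftrightarrow> a * d - b * c \<noteq> (0::'k::field)"
  by (simp add: invertible_det_nz det_matrix2)

text \<open>Five values determine the five coordinates: the resulting linear system has only powers
  of 2 and 3 to divide by.\<close>

lemma quartic_inject:
  fixes s t :: "'k::field tensor4"
  assumes "(2::'k) \<noteq> 0" "(3::'k) \<noteq> 0" and s: "s \<in> sym_tensors" and t: "t \<in> sym_tensors"
    and eq: "\<And>w. quartic s w = quartic t w"
  shows "s = t"
proof -
  obtain a0 a1 a2 a3 a4 where a: "s = bq a0 a1 a2 a3 a4" by (rule sym_tensor_bq[OF s])
  obtain b0 b1 b2 b3 b4 where b: "t = bq b0 b1 b2 b3 b4" by (rule sym_tensor_bq[OF t])
  have E: "a0 * y ^ 4 - 4 * (a1 * (x * y ^ 3)) + 6 * (a2 * (x ^ 2 * y ^ 2))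
     - 4 * (a3 * (x ^ 3 * y)) + a4 * x ^ 4 = b0 * y ^ 4 - 4 * (b1 * (x * y ^ 3)) + 6 * (b2 * (x ^ 2 * y ^ 2))
     - 4 * (b3 * (x ^ 3 * y)) + b4 * x ^ 4" for x y
    using eq[of "vector [x, y]"] by (simp add: a b quartic_bq)
  \<comment> \<open>In \<open>E\<close> the variable \<open>y\<close> occurs first, so
    \<open>of\<close> instantiates \<open>y\<close> before \<open>x\<close>. The five points (x, y)
    are (0, 1), (1, 0), (1, 1), (1, -1) and (2, 1).\<close>
  have 0: "a0 = b0" using E[of 1 0] by simp
  have 4: "a4 = b4" using E[of 0 1] by simp
  have e1: "6 * a2 - 4 * a1 - 4 * a3 = 6 * b2 - 4 * b1 - 4 * b3"
    by (insert E[of 1 1], simp add: 0 4, algebra)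
  have e2: "6 * a2 + 4 * a1 + 4 * a3 = 6 * b2 + 4 * b1 + 4 * b3"
    by (insert E[of "-1" 1], simp add: 0 4, algebra)
  have e3: "24 * a2 - 8 * a1 - 32 * a3 = 24 * b2 - 8 * b1 - 32 * b3"
    by (insert E[of 1 2], simp add: 0 4, algebra)
  have "2 * 2 * 3 * (a2 - b2) = 0" using e1 e2 by algebra
  then have 2: "a2 = b2" using assms(1,2) unfolding mult_eq_0_iff by auto
  have "2 * 2 * 2 * 3 * (a3 - b3) = 0" using e1 e2 e3 by algebra
  then have 3: "a3 = b3" using assms(1,2) unfolding mult_eq_0_iff by auto
  have "2 * 2 * (a1 - b1) = 0" using e1 2 3 by algebra
  then have "a1 = b1" using assms(1,2) unfolding mult_eq_0_iff by auto
  with 0 2 3 4 show ?thesis by (simp add: a b)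
qed

text \<open>Reduces the action on tensors to a substitution in quartics: as \<open>A\<close> is
  invertible, every vector has the form \<open>A *v w\<close>.\<close>

lemma tensor_map_eqI:
  fixes s t :: "'k::field tensor4"
  assumes "(2::'k) \<noteq> 0" "(3::'k) \<noteq> 0" "s \<in> sym_tensors" "t \<in> sym_tensors" "invertible A"
    and eq: "\<And>w. quartic t (A *v w) = det A ^ 4 * quartic s w"
  shows "tensor_map A s = t"
proof (rule quartic_inject)
  fix u
  obtain B where "A ** B = mat 1" using assms by (auto simp: invertible_def)
  then have "u = A *v (B *v u)" by (simp add: matrix_vector_mul_assoc)
  then show "quartic (tensor_map A s) u = quartic t u" by (metis eq quartic_map)
qed (use assms in \<open>simp_all add: tensor_map_sym\<close>)

text \<open>The orbit relation on 1-spaces, expressed by generators; see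
  \<open>orbit_PGL2_iff\<close>.\<close>

definition proj_equiv :: "'k::field tensor4 \<Rightarrow> 'k tensor4 \<Rightarrow> bool" where
  "proj_equiv s t \<longleftrightarrow> (\<exists>A c. invertible A \<and> c \<noteq> 0 \<and> tensor_map A s = c *s t)"

lemma proj_equivI: "invertible A \<Longrightarrow> c \<noteq> 0 \<Longrightarrow> tensor_map A s = c *s t \<Longrightarrow> proj_equiv s t"
  by (auto simp: proj_equiv_def)

lemma proj_equiv_scale: "c \<noteq> 0 \<Longrightarrow> proj_equiv (c *s t) t"
  by (rule proj_equivI[of "mat 1" c]) (simp_all add: invertible_mat tensor_map_mat)

lemma proj_equiv_trans:
  assumes "proj_equiv s t" "proj_equiv t u"
  shows "proj_equiv s u"
proof -
  obtain A c B d where A: "invertible A" "c \<noteq> 0" "tensor_map A s = c *s t"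
    and B: "invertible B" "d \<noteq> 0" "tensor_map B t = d *s u"
    using assms by (auto simp: proj_equiv_def)
  show ?thesis
    by (rule proj_equivI[of "B ** A" "c * d"])
      (use A B in \<open>simp_all add: invertible_mult tensor_map_mult tensor_map_scale\<close>)
qed

lemma proj_equiv_sym:
  assumes "proj_equiv s t"
  shows "proj_equiv t s"
proof -
  obtain A c where A: "invertible A" "c \<noteq> 0" "tensor_map A s = c *s t"
    using assms by (auto simp: proj_equiv_def)
  obtain B where B: "A ** B = mat 1" "B ** A = mat 1" using A by (auto simp: invertible_def)
  have "s = tensor_map B (c *s t)"
    by (simp flip: A(3) tensor_map_mult add: B tensor_map_mat)
  then have "tensor_map B t = inverse c *s s" using A by (simp add: tensor_map_scale)
  moreover have "invertible B" using B by (auto simp: invertible_def)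
  ultimately show ?thesis using A by (intro proj_equivI[of B "inverse c"]) auto
qed

text \<open>The form of \<open>tensor_map_eqI\<close> used for explicit matrices: what remains is a
  polynomial identity in \<open>x\<close> and \<open>y\<close>, accessible to
  \<open>algebra\<close>.\<close>

lemma tensor_map_matrix2:
  fixes a b c d :: "'k::field"
  assumes "(2::'k) \<noteq> 0" "(3::'k) \<noteq> 0" "a * d - b * c \<noteq> 0"
    and "\<And>x y. b0 * (c * x + d * y) ^ 4 - 4 * (b1 * ((a * x + b * y) * (c * x + d * y) ^ 3))
        + 6 * (b2 * ((a * x + b * y) ^ 2 * (c * x + d * y) ^ 2))
        - 4 * (b3 * ((a * x + b * y) ^ 3 * (c * x + d * y))) + b4 * (a * x + b * y) ^ 4
      = (a * d - b * c) ^ 4 * (a0 * y ^ 4 - 4 * (a1 * (x * y ^ 3)) + 6 * (a2 * (x ^ 2 * y ^ 2))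
        - 4 * (a3 * (x ^ 3 * y)) + a4 * x ^ 4)"
  shows "tensor_map (matrix2 a b c d) (bq a0 a1 a2 a3 a4) = bq b0 b1 b2 b3 b4"
  by (rule tensor_map_eqI)
    (use assms in \<open>simp_all add: bq_sym invertible_matrix2 quartic_bq matrix2_mult_vec det_matrix2\<close>)

section \<open>Roots and normal forms of singular quartics\<close>

lemma quartic_root:
  fixes t :: "'k::alg_closed_field tensor4"
  assumes "t \<in> sym_tensors"
  obtains w where "w \<noteq> 0" "quartic t w = 0"
proof -
  obtain a0 a1 a2 a3 a4 where a: "t = bq a0 a1 a2 a3 a4" by (rule sym_tensor_bq[OF assms])
  show thesis
  proof (cases "a4 = 0")
    case True
    show thesis
      by (rule that[of "vector [1, 0]"]) (simp_all add: a quartic_bq True vec_eq_iff forall_2)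
  next
    case False
    \<comment> \<open>With \<open>a4\<close> nonzero the dehomogenized polynomial has degree 4,
      hence a root.\<close>
    then obtain x where "poly [:a0, - 4 * a1, 6 * a2, - 4 * a3, a4:] x = 0"
      using alg_closed_imp_poly_has_root[of "[:a0, - 4 * a1, 6 * a2, - 4 * a3, a4:]"] by auto
    then have "quartic t (vector [x, 1]) = 0"
      by (simp add: a quartic_bq algebra_simps power2_eq_square power3_eq_cube power4_eq_xxxx)
    then show thesis
      by (rule that[rotated]) (simp add: vec_eq_iff forall_2)
  qed
qed

lemma quad_form_map: "quad_form (tensor_map A t) = det A ^ 4 * quad_form t"
  by (simp add: quad_form_def tensor_form_map)

text \<open>The diagonal matrix with entries \<open>m\<close> and 1 multiplies the first coordinate
  by \<open>m ^ 4\<close> and the fourth by \<open>m\<close>. Their ratio changes by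
  \<open>m ^ 3\<close>, and a cube root makes it 4.\<close>

lemma proj_equiv_double_form:
  fixes a0 :: "'k::alg_closed_field"
  assumes nz: "(2::'k) \<noteq> 0" "(3::'k) \<noteq> 0" and "a0 \<noteq> 0" "a3 \<noteq> 0"
  shows "proj_equiv (bq a0 0 0 a3 0) (bq 4 0 0 1 0)"
proof -
  obtain m where m: "m ^ 3 = 4 * a3 / a0" using nth_root_exists[of 3 "4 * a3 / a0"] by auto
  have 4: "(4::'k) \<noteq> 0" using nz by (metis mult_2 mult_eq_0_iff numeral_Bit0)
  with m assms have m0: "m \<noteq> 0" by auto
  have m': "m ^ 3 * a0 = 4 * a3" using m assms by simp
  have "4 * (m ^ 4 * a0 / 4) = m ^ 4 * a0" using 4 by simp
  then obtain c where c: "4 * c = m ^ 4 * a0" "c \<noteq> 0" using m0 assms 4 by fastforce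
  have c': "c * m ^ 3 = m ^ 4 * a3"
  proof -
    have "4 * (c * m ^ 3 - m ^ 4 * a3) = 0" using c m' by algebra
    then show ?thesis using 4 by simp
  qed
  have "tensor_map (matrix2 m 0 0 1) (bq a0 0 0 a3 0) = bq (c * 4) 0 0 c 0"
  proof (rule tensor_map_matrix2)
    fix x y
    show "c * 4 * (0 * x + 1 * y) ^ 4 - 4 * (0 * ((m * x + 0 * y) * (0 * x + 1 * y) ^ 3)) +
           6 * (0 * ((m * x + 0 * y)\<^sup>2 * (0 * x + 1 * y)\<^sup>2)) -
           4 * (c * ((m * x + 0 * y) ^ 3 * (0 * x + 1 * y))) + 0 * (m * x + 0 * y) ^ 4 =
           (m * 1 - 0 * 0) ^ 4 *
           (a0 * y ^ 4 - 4 * (0 * (x * y ^ 3)) + 6 * (0 * (x\<^sup>2 * y\<^sup>2)) -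
            4 * (a3 * (x ^ 3 * y)) + 0 * x ^ 4)"
      using c(1) c' by algebra
  qed (use nz m0 in auto)
  then show ?thesis
    by (intro proj_equivI[of "matrix2 m 0 0 1" c]) (use c m0 in \<open>simp_all add: invertible_matrix2 bq_scale\<close>)
qed

lemma proj_equiv_swap:
  fixes a0 :: "'k::field"
  assumes nz: "(2::'k) \<noteq> 0" "(3::'k) \<noteq> 0"
  shows "proj_equiv (bq a0 a1 a2 a3 a4) (bq a4 a3 a2 a1 a0)"
proof -
  have "tensor_map (matrix2 0 1 1 0) (bq a0 a1 a2 a3 a4) = bq a4 a3 a2 a1 a0"
    by (rule tensor_map_matrix2) (use nz in \<open>simp_all add: mult_ac algebra_simps\<close>)
  then show ?thesis
    by (intro proj_equivI[of "matrix2 0 1 1 0" 1]) (simp_all add: invertible_matrix2)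
qed

text \<open>The shear fixes the root at infinity. The new coordinates are given recursively, so that
  \<open>b1\<close> and \<open>b0\<close> simplify once \<open>s\<close> has been chosen to kill
  \<open>b2\<close>.\<close>

lemma tensor_map_shear:
  fixes s :: "'k::field"
  assumes nz: "(2::'k) \<noteq> 0" "(3::'k) \<noteq> 0"
    and b: "b2 = a2 + 2 * s * a3" "b1 = a1 + 3 * s * b2 - 3 * s ^ 2 * a3"
      "b0 = a0 + 4 * s * b1 - 6 * s ^ 2 * b2 + 4 * s ^ 3 * a3"
  shows "tensor_map (matrix2 1 s 0 1) (bq a0 a1 a2 a3 0) = bq b0 b1 b2 a3 0"
proof (rule tensor_map_matrix2[OF nz])
  fix x y
  have "b0 * y ^ 4 - 4 * (b1 * ((x + s * y) * y ^ 3)) + 6 * (b2 * ((x + s * y) ^ 2 * y ^ 2))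
      - 4 * (a3 * ((x + s * y) ^ 3 * y)) =
    a0 * y ^ 4 - 4 * (a1 * (x * y ^ 3)) + 6 * (a2 * (x ^ 2 * y ^ 2)) - 4 * (a3 * (x ^ 3 * y))"
    using b by algebra
  then show "b0 * (0 * x + 1 * y) ^ 4 - 4 * (b1 * ((1 * x + s * y) * (0 * x + 1 * y) ^ 3))
        + 6 * (b2 * ((1 * x + s * y) ^ 2 * (0 * x + 1 * y) ^ 2))
        - 4 * (a3 * ((1 * x + s * y) ^ 3 * (0 * x + 1 * y))) + 0 * (1 * x + s * y) ^ 4
      = (1 * 1 - s * 0) ^ 4 * (a0 * y ^ 4 - 4 * (a1 * (x * y ^ 3)) + 6 * (a2 * (x ^ 2 * y ^ 2))
        - 4 * (a3 * (x ^ 3 * y)) + 0 * x ^ 4)"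
    by simp
qed simp

lemma singular_normal_form:
  fixes t :: "'k::alg_closed_field tensor4"
  assumes nz: "(2::'k) \<noteq> 0" "(3::'k) \<noteq> 0"
    and t: "t \<in> sym_tensors" "t \<noteq> 0" "quad_form t = 0"
  shows "proj_equiv t (bq 1 0 0 0 0) \<or> proj_equiv t (bq 0 1 0 0 0) \<or> proj_equiv t (bq 4 0 0 1 0)"
proof -
  have 4: "(4::'k) \<noteq> 0" using nz by (metis mult_2 mult_eq_0_iff numeral_Bit0)
  obtain w where w: "w \<noteq> 0" "quartic t w = 0" by (rule quartic_root[OF t(1)])
  \<comment> \<open>Choose a matrix moving the root \<open>w\<close> to infinity, the point with
    second coordinate 0.\<close>
  obtain A :: "'k^2^2" where A: "invertible A" "(A *v w) $ 2 = 0"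
  proof (cases "w $ 1 = 0")
    case True
    then show thesis
      by (intro that[of "matrix2 0 1 1 0"]) (simp_all add: invertible_matrix2 matrix2_mult_vec)
  next
    case False
    then show thesis
      by (intro that[of "matrix2 1 0 (- w $ 2) (w $ 1)"])
        (simp_all add: invertible_matrix2 matrix2_mult_vec)
  qed
  let ?s = "tensor_map A t"
  obtain b0 b1 b2 b3 b4 where b: "?s = bq b0 b1 b2 b3 b4"
    by (rule sym_tensor_bq[OF tensor_map_sym[OF t(1)]])
  have ts: "proj_equiv t (bq b0 b1 b2 b3 b4)"
    by (rule proj_equivI[of A 1]) (use A b in simp_all)
  have Aw: "A *v w \<noteq> 0"
    using A(1) w(1) by (metis invertible_def matrix_vector_mul_assoc matrix_vector_mul_lid
        matrix_vector_mult_0_right)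
  then have "(A *v w) $ 1 \<noteq> 0" using A(2) by (auto simp: vec_eq_iff forall_2)
  moreover have "quartic ?s (A *v w) = 0" using w by (simp add: quartic_map)
  ultimately have b4: "b4 = 0" by (simp add: b quartic_bq A(2))
  have s0: "bq b0 b1 b2 b3 b4 \<noteq> 0" using tensor_map_eq_0_iff[OF A(1)] t(2) by (simp flip: b)
  have "quad_form ?s = 0" by (simp add: quad_form_map t)
  then have "b0 * b4 - 4 * (b1 * b3) + 3 * b2 ^ 2 = 0"
    using nz(1) unfolding b quad_form_bq by (simp only: mult_eq_0_iff simp_thms)
  then have q: "3 * b2 ^ 2 = 4 * (b1 * b3)" using b4 by algebra
  show ?thesis
  proof (cases "b3 = 0")
    \<comment> \<open>The root at infinity is multiple: the form is divisible by y^2, and by y^3 as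
      soon as \<open>b2 = 0\<close>.\<close>
    case True
    with q nz have b2: "b2 = 0" by simp
    show ?thesis
    proof (cases "b1 = 0")
      case True
      with s0 b2 b4 \<open>b3 = 0\<close> have "b0 \<noteq> 0" by (auto simp: bq_0)
      then have "proj_equiv (bq b0 b1 b2 b3 b4) (bq 1 0 0 0 0)"
        using proj_equiv_scale[of b0 "bq 1 0 0 0 0"] True b2 b4 \<open>b3 = 0\<close> by (simp add: bq_scale)
      then show ?thesis using proj_equiv_trans[OF ts] by blast
    next
      case False
      \<comment> \<open>With \<open>b2 = b3 = 0\<close> the shear adds \<open>4 * s * b1\<close> to
        \<open>b0\<close>; this choice kills it.\<close>
      define s where "s = - b0 / (4 * b1)"
      have s: "4 * s * b1 + b0 = 0" using 4 False by (simp add: s_def)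
      have "tensor_map (matrix2 1 s 0 1) (bq b0 b1 0 0 0) = bq 0 b1 0 0 0"
        by (rule tensor_map_shear[OF nz]) (use s in \<open>simp_all add: algebra_simps\<close>)
      then have "proj_equiv (bq b0 b1 0 0 0) (bq 0 1 0 0 0)"
        using False by (intro proj_equivI[of "matrix2 1 s 0 1" b1])
          (simp_all add: invertible_matrix2 bq_scale)
      then show ?thesis using proj_equiv_trans[OF ts] b2 b4 \<open>b3 = 0\<close> by blast
    qed
  next
    case False
    \<comment> \<open>This translation kills \<open>b2\<close>; singularity then kills the second
      coordinate too, which is what \<open>b1\<close> below expresses.\<close>
    define s where "s = - b2 / (2 * b3)"
    have s: "b2 + 2 * s * b3 = 0" using nz False by (simp add: s_def)
    have b1: "b1 = 3 * b3 * s ^ 2"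
    proof -
      have "4 * b3 * (b1 - 3 * b3 * s ^ 2) = 0" using s q by algebra
      then show ?thesis using 4 False by simp
    qed
    define c where "c = b0 + 4 * b3 * s ^ 3"
    have "tensor_map (matrix2 1 s 0 1) (bq b0 b1 b2 b3 0) = bq c 0 0 b3 0"
      by (rule tensor_map_shear[OF nz]) (use s b1 c_def in \<open>simp_all add: algebra_simps\<close>)
    then have "proj_equiv (bq b0 b1 b2 b3 0) (bq c 0 0 b3 0)"
      by (intro proj_equivI[of "matrix2 1 s 0 1" 1]) (simp_all add: invertible_matrix2)
    with ts b4 have tc: "proj_equiv t (bq c 0 0 b3 0)" by (blast intro: proj_equiv_trans)
    show ?thesis
    proof (cases "c = 0")
      case True
      \<comment> \<open>Here the form is a multiple of x^3 y, whose triple root is at zero; the swap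
        moves it to infinity.\<close>
      have "proj_equiv (b3 *s bq 0 0 0 1 0) (bq 0 1 0 0 0)"
        using proj_equiv_trans[OF proj_equiv_scale[OF False] proj_equiv_swap[OF nz]] .
      then show ?thesis using tc True by (auto simp: bq_scale intro: proj_equiv_trans)
    next
      case False
      then show ?thesis
        using proj_equiv_trans[OF tc proj_equiv_double_form[OF nz False \<open>b3 \<noteq> 0\<close>]] by blast
    qed
  qed
qed


section \<open>The three orbits\<close>

text \<open>If u = (x, z) and v = (y, w) are the columns of \<open>A\<close>, the image is a times
  the fourth power of u plus b times the sum of the four placements of v among three copies of
  u.\<close>

lemma tensor_map_triple_root:
  fixes a b :: "'k::comm_ring_1" and A :: "'k ^ 2 ^ 2"
  defines "x \<equiv> A $ 1 $ 1" and "y \<equiv> A $ 1 $ 2" and "z \<equiv> A $ 2 $ 1" and "w \<equiv> A $ 2 $ 2"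
  shows "tensor_map A (bq a b 0 0 0) $ index4 1 1 1 1 = a * x ^ 4 + 4 * b * x ^ 3 * y"
    and "tensor_map A (bq a b 0 0 0) $ index4 1 1 1 2 =
      a * x ^ 3 * z + b * (x ^ 3 * w + 3 * x ^ 2 * y * z)"
    and "tensor_map A (bq a b 0 0 0) $ index4 1 1 2 2 =
      a * x ^ 2 * z ^ 2 + 2 * b * (x ^ 2 * z * w + x * y * z ^ 2)"
    and "tensor_map A (bq a b 0 0 0) $ index4 1 2 2 2 =
      a * x * z ^ 3 + b * (y * z ^ 3 + 3 * x * z ^ 2 * w)"
    and "tensor_map A (bq a b 0 0 0) $ index4 2 2 2 2 = a * z ^ 4 + 4 * b * z ^ 3 * w"
  unfolding tensor_map_def vec_lambda_beta sum_index4 prod_4 index4_simps sum_2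
    x_def[symmetric] y_def[symmetric] z_def[symmetric] w_def[symmetric]
  by (simp_all add: bq_def twos_index4 algebra_simps power2_eq_square power3_eq_cube power4_eq_xxxx)

text \<open>Differences are written with \<open>(-1) *\<close> so that the closure rules of
  \<open>homogeneous_poly\<close> apply term by term.\<close>

definition catalecticant :: "'k::comm_ring_1 tensor4 \<Rightarrow> 'k" where
  "catalecticant t =
     (let a0 = t $ index4 1 1 1 1; a1 = t $ index4 1 1 1 2; a2 = t $ index4 1 1 2 2;
          a3 = t $ index4 1 2 2 2; a4 = t $ index4 2 2 2 2
      in a0 * a2 * a4 + 2 * (a1 * a2 * a3) + (-1) * (a2 * a2 * a2) + (-1) * (a0 * a3 * a3)
         + (-1) * (a1 * a1 * a4))"

lemma catalecticant_scale: "catalecticant (c *s t) = c ^ 3 * catalecticant t"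
  by (simp add: catalecticant_def Let_def power3_eq_cube algebra_simps)

text \<open>The catalecticant is the determinant of the Hankel matrix of \<open>t\<close>. If the quartic has a triple
  root, the square of the corresponding linear form lies in the kernel.\<close>

lemma catalecticant_triple_root:
  fixes A :: "'k::field ^ 2 ^ 2"
  assumes "invertible A"
  shows "catalecticant (tensor_map A (bq a b 0 0 0)) = 0"
proof -
  define x y z w where "x = A $ 1 $ 1" and "y = A $ 1 $ 2" and "z = A $ 2 $ 1" and "w = A $ 2 $ 2"
  let ?t = "tensor_map A (bq a b 0 0 0)"
  define b0 b1 b2 b3 b4 where b_def: "b0 = ?t $ index4 1 1 1 1" "b1 = ?t $ index4 1 1 1 2"
    "b2 = ?t $ index4 1 1 2 2" "b3 = ?t $ index4 1 2 2 2" "b4 = ?t $ index4 2 2 2 2"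
  note b = b_def[unfolded tensor_map_triple_root, folded x_def y_def z_def w_def]
  \<comment> \<open>The three equations say that (z^2, -2xz, x^2) lies in the kernel of the Hankel
    matrix.\<close>
  have k0: "b0 * z ^ 2 - 2 * x * z * b1 + x ^ 2 * b2 = 0" unfolding b by algebra
  have k1: "b1 * z ^ 2 - 2 * x * z * b2 + x ^ 2 * b3 = 0" unfolding b by algebra
  have k2: "b2 * z ^ 2 - 2 * x * z * b3 + x ^ 2 * b4 = 0" unfolding b by algebra
  define J where "J = b0 * b2 * b4 + 2 * (b1 * b2 * b3) + (-1) * (b2 * b2 * b2)
     + (-1) * (b0 * b3 * b3) + (-1) * (b1 * b1 * b4)"
  \<comment> \<open>Combining the equations with the cofactors of the first column isolates the
    first kernel entry; the third column is treated likewise below. One of x, z is nonzero since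
    they form a column of \<open>A\<close>.\<close>
  have "J * z ^ 2 = (b2 * b4 - b3 * b3) * (b0 * z ^ 2 - 2 * x * z * b1 + x ^ 2 * b2)
      - (b1 * b4 - b2 * b3) * (b1 * z ^ 2 - 2 * x * z * b2 + x ^ 2 * b3)
      + (b1 * b3 - b2 * b2) * (b2 * z ^ 2 - 2 * x * z * b3 + x ^ 2 * b4)"
    unfolding J_def by algebra
  then have z: "J * z ^ 2 = 0" by (simp only: k0 k1 k2) simp
  have "J * x ^ 2 = (b1 * b3 - b2 * b2) * (b0 * z ^ 2 - 2 * x * z * b1 + x ^ 2 * b2)
      - (b0 * b3 - b1 * b2) * (b1 * z ^ 2 - 2 * x * z * b2 + x ^ 2 * b3)
      + (b0 * b2 - b1 * b1) * (b2 * z ^ 2 - 2 * x * z * b3 + x ^ 2 * b4)"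
    unfolding J_def by algebra
  then have x: "J * x ^ 2 = 0" by (simp only: k0 k1 k2) simp
  have "x * w - y * z \<noteq> 0"
    using assms by (simp add: invertible_det_nz det_2 x_def y_def z_def w_def)
  then have "x \<noteq> 0 \<or> z \<noteq> 0" by auto
  with x z have "J = 0" by auto
  then show ?thesis
    by (simp only: catalecticant_def Let_def b_def[symmetric] J_def)
qed

section \<open>Orbits of 1-spaces and projective equivalence of generators\<close>

definition singular_vectors :: "'k::field tensor4 set" where
  "singular_vectors = {t \<in> sym_tensors. t \<noteq> 0 \<and> quad_form t = 0}"

lemma singular_one_spaces_eq: "singular_one_spaces = (\<lambda>t. vec.span {t}) ` singular_vectors"
  by (auto simp: singular_one_spaces_def singular_vectors_def)

lemma span_singleton_eqD:
  assumes "vec.span {u} = vec.span {v}" "v \<noteq> (0 :: 'k::field ^ 'n)"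
  obtains c where "c \<noteq> 0" "u = c *s v"
proof -
  have "u \<in> vec.span {v}" using assms(1) vec.span_base[of u "{u}"] by simp
  then obtain c where c: "u = c *s v" by (auto simp: vec.span_singleton)
  moreover have "c \<noteq> 0"
  proof
    assume "c = 0"
    with c have "vec.span {u} = {0}" by simp
    moreover have "v \<in> vec.span {v}" by (simp add: vec.span_base)
    ultimately show False using assms by simp
  qed
  ultimately show thesis by (rule that[rotated])
qed

lemma span_scale_eq:
  assumes "c \<noteq> (0::'k::field)"
  shows "vec.span {c *s v} = vec.span {v}"
proof -
  have "(*s) c ` vec.span {v} = vec.span {c *s v}"
    by (auto simp: vec.span_singleton image_iff mult_ac)
  then show ?thesis using span_scale_image[OF assms, of v] by simp
qed

lemma carrier_PGL2: "carrier PGL2 = {scalar_matrices #>\<^bsub>GL2\<^esub> A | A. invertible A}"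
  by (auto simp: PGL2_def FactGroup_def RCOSETS_def GL2_simps)

text \<open>Two nonzero vectors spanning the same line differ by a nonzero scalar, which is the
  \<open>c\<close> in \<open>proj_equiv\<close>.\<close>

lemma orbit_PGL2_iff:
  assumes "s \<in> singular_vectors" "t \<noteq> 0"
  shows "vec.span {t} \<in> orbit PGL2 PGL2_act (vec.span {s}) \<longleftrightarrow> proj_equiv s t"
proof -
  have L: "vec.span {s} \<in> singular_one_spaces"
    using assms by (simp add: singular_one_spaces_eq)
  have "vec.span {t} \<in> orbit PGL2 PGL2_act (vec.span {s}) \<longleftrightarrow>
      (\<exists>A. invertible A \<and> vec.span {t} = PGL2_act (scalar_matrices #>\<^bsub>GL2\<^esub> A) (vec.span {s}))"
    unfolding orbit_def carrier_PGL2 by blast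
  also have "\<dots> \<longleftrightarrow> (\<exists>A. invertible A \<and> vec.span {t} = vec.span {tensor_map A s})"
    by (simp only: PGL2_act_coset[OF L] tensor_map_span)
  also have "\<dots> \<longleftrightarrow> proj_equiv s t"
  proof
    assume "\<exists>A. invertible A \<and> vec.span {t} = vec.span {tensor_map A s}"
    then obtain A where A: "invertible A" "vec.span {tensor_map A s} = vec.span {t}" by metis
    show "proj_equiv s t"
      by (rule span_singleton_eqD[OF A(2) assms(2)]) (rule proj_equivI[OF A(1)])
  next
    assume "proj_equiv s t"
    then show "\<exists>A. invertible A \<and> vec.span {t} = vec.span {tensor_map A s}"
      unfolding proj_equiv_def using span_scale_eq by metis
  qed
  finally show ?thesis .
qed

lemma bq_eq_0_iff: "bq a0 a1 a2 a3 a4 = 0 \<longleftrightarrow> a0 = 0 \<and> a1 = 0 \<and> a2 = 0 \<and> a3 = 0 \<and> a4 = 0"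
  using bq_eq_iff[of a0 a1 a2 a3 a4 0 0 0 0 0] by (simp add: bq_0)

lemma normal_forms_singular:
  "bq 1 0 0 0 0 \<in> singular_vectors" "bq 0 1 0 0 0 \<in> singular_vectors"
  "bq 4 0 0 1 0 \<in> singular_vectors"
  by (simp_all add: singular_vectors_def bq_sym quad_form_bq bq_eq_0_iff)

lemma catalecticant_bq:
  "catalecticant (bq a0 a1 a2 a3 a4) = a0 * a2 * a4 + 2 * (a1 * a2 * a3) + (-1) * (a2 * a2 * a2)
     + (-1) * (a0 * a3 * a3) + (-1) * (a1 * a1 * a4)"
  by (simp only: catalecticant_def Let_def bq_coords)

lemma catalecticant_proj_equiv:
  assumes "proj_equiv t (bq a b 0 0 0)"
  shows "catalecticant t = 0"
proof -
  obtain A c where A: "invertible A" "c \<noteq> 0" "tensor_map A (bq a b 0 0 0) = c *s t"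
    using proj_equiv_sym[OF assms] by (auto simp: proj_equiv_def)
  have "catalecticant (c *s t) = 0" by (simp flip: A(3) add: catalecticant_triple_root A(1))
  then show ?thesis using A by (simp add: catalecticant_scale)
qed

text \<open>The image of the fourth power of the first basis vector is the fourth power of (x, z).
  Its coordinates x^4 and x^3 z cannot be 0 and nonzero.\<close>

lemma not_proj_equiv_powers: "\<not> proj_equiv (bq 1 0 0 0 0) (bq 0 1 0 0 0 :: 'k::field tensor4)"
proof
  assume "proj_equiv (bq 1 0 0 0 0) (bq 0 1 0 0 0 :: 'k tensor4)"
  then obtain A c where A: "c \<noteq> (0::'k)" "tensor_map A (bq 1 0 0 0 0) = c *s bq 0 1 0 0 0"
    by (auto simp: proj_equiv_def)
  have "tensor_map A (bq 1 0 0 0 0) $ index4 1 1 1 1 = 0"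
    "tensor_map A (bq 1 0 0 0 0) $ index4 1 1 1 2 = c"
    by (simp_all add: A bq_scale bq_coords)
  then show False using A(1) by (simp add: tensor_map_triple_root)
qed

lemma not_proj_equiv_double_form:
  assumes "(2::'k::field) \<noteq> 0"
  shows "\<not> proj_equiv (bq 4 0 0 1 0) (bq a b 0 0 0 :: 'k tensor4)"
proof
  assume "proj_equiv (bq 4 0 0 1 0) (bq a b 0 0 0 :: 'k tensor4)"
  then have "catalecticant (bq 4 0 0 1 0 :: 'k tensor4) = 0" by (rule catalecticant_proj_equiv)
  then have "2 * 2 = (0::'k)" by (simp add: catalecticant_bq)
  then show False using assms unfolding mult_eq_0_iff by simp
qed

definition normal_forms :: "'k::field tensor4 set" where
  "normal_forms = {bq 1 0 0 0 0, bq 0 1 0 0 0, bq 4 0 0 1 0}"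

lemma PGL2_orbits:
  assumes nz: "(2::'k::alg_closed_field) \<noteq> 0" "(3::'k) \<noteq> 0"
  shows "orbits PGL2 (singular_one_spaces :: 'k tensor4 set set) PGL2_act =
    (\<lambda>t. orbit PGL2 PGL2_act (vec.span {t})) ` normal_forms"
proof -
  interpret group_action "PGL2 :: ('k^2^2) set monoid" singular_one_spaces PGL2_act
    by (rule PGL2_group_action)
  have 1: "orbit PGL2 PGL2_act (vec.span {s}) = orbit PGL2 PGL2_act (vec.span {t})"
    if "s \<in> singular_vectors" "t \<in> singular_vectors" "proj_equiv s t" for s t :: "'k tensor4"
  proof -
    have E: "vec.span {s} \<in> singular_one_spaces" "vec.span {t} \<in> singular_one_spaces"
      using that by (simp_all add: singular_one_spaces_eq)
    have "vec.span {t} \<in> orbit PGL2 PGL2_act (vec.span {s})"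
      using that by (subst orbit_PGL2_iff) (auto simp: singular_vectors_def)
    then have "vec.span {t} \<in> orbit PGL2 PGL2_act (vec.span {s}) \<inter> orbit PGL2 PGL2_act (vec.span {t})"
      using orbit_refl E by blast
    then show ?thesis
      using disjoint_union[of "orbit PGL2 PGL2_act (vec.span {s})" "orbit PGL2 PGL2_act (vec.span {t})"] E
      by (auto simp: orbits_def)
  qed
  show ?thesis
  proof
    show "(\<lambda>t. orbit PGL2 PGL2_act (vec.span {t})) ` normal_forms
        \<subseteq> orbits PGL2 (singular_one_spaces :: 'k tensor4 set set) PGL2_act"
      using normal_forms_singular by (force simp: normal_forms_def orbits_def singular_one_spaces_eq)
    show "orbits PGL2 (singular_one_spaces :: 'k tensor4 set set) PGL2_act
        \<subseteq> (\<lambda>t. orbit PGL2 PGL2_act (vec.span {t})) ` normal_forms"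
    proof
      fix \<Omega> assume "\<Omega> \<in> orbits PGL2 (singular_one_spaces :: 'k tensor4 set set) PGL2_act"
      then obtain t where t: "t \<in> singular_vectors" "\<Omega> = orbit PGL2 PGL2_act (vec.span {t})"
        by (auto simp: orbits_def singular_one_spaces_eq)
      then obtain u where u: "u \<in> normal_forms" "proj_equiv t u"
        using singular_normal_form[OF nz, of t] by (auto simp: singular_vectors_def normal_forms_def)
      then have "u \<in> singular_vectors" using normal_forms_singular by (auto simp: normal_forms_def)
      with t u show "\<Omega> \<in> (\<lambda>t. orbit PGL2 PGL2_act (vec.span {t})) ` normal_forms"
        using 1 by blast
    qed
  qed
qed

lemma card_PGL2_orbits:
  assumes nz: "(2::'k::alg_closed_field) \<noteq> 0" "(3::'k) \<noteq> 0"
  shows "card (orbits PGL2 (singular_one_spaces :: 'k tensor4 set set) PGL2_act) = 3"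
proof -
  interpret group_action "PGL2 :: ('k^2^2) set monoid" singular_one_spaces PGL2_act
    by (rule PGL2_group_action)
  have ne: "u \<noteq> v \<Longrightarrow> \<not> proj_equiv u v" if "u \<in> normal_forms" "v \<in> normal_forms" for u v :: "'k tensor4"
    using that not_proj_equiv_powers[where 'k = 'k] not_proj_equiv_double_form[OF nz(1)] proj_equiv_sym
    unfolding normal_forms_def by auto
  have inj: "inj_on (\<lambda>t. orbit PGL2 PGL2_act (vec.span {t})) (normal_forms :: 'k tensor4 set)"
  proof (rule inj_onI, rule ccontr)
    fix u v :: "'k tensor4"
    assume uv: "u \<in> normal_forms" "v \<in> normal_forms" "u \<noteq> v"
      "orbit PGL2 PGL2_act (vec.span {u}) = orbit PGL2 PGL2_act (vec.span {v})"
    then have S: "u \<in> singular_vectors" "v \<in> singular_vectors"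
      using normal_forms_singular by (auto simp: normal_forms_def)
    have "vec.span {v} \<in> orbit PGL2 PGL2_act (vec.span {u})"
      using uv(4) orbit_refl[of "vec.span {v}"] S by (simp add: singular_one_spaces_eq)
    then have "proj_equiv u v" using S by (subst (asm) orbit_PGL2_iff) (auto simp: singular_vectors_def)
    then show False using ne uv by blast
  qed
  have "card (normal_forms :: 'k tensor4 set) = 3"
    unfolding normal_forms_def by (simp add: bq_eq_iff)
  then show ?thesis
    unfolding PGL2_orbits[OF nz] by (simp add: card_image[OF inj])
qed

section \<open>Density of the open orbit\<close>

lemma homogeneous_poly_scale:
  assumes "homogeneous_poly d f"
  shows "f (c *s t) = c ^ d * f t"
  using assms by (induction) (simp_all add: power_add algebra_simps)

text \<open>Reduces density along a line to a question about polynomials in one variable.\<close>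

lemma homogeneous_poly_line:
  fixes f :: "'k::field tensor4 \<Rightarrow> 'k"
  assumes "homogeneous_poly d f"
  shows "\<exists>q. \<forall>s. f (v + s *s u) = poly q s"
  using assms
proof induction
  case (const c)
  show ?case by (rule exI[of _ "[:c:]"]) simp
next
  case (coord i)
  show ?case by (rule exI[of _ "[:v $ i, u $ i:]"]) simp
next
  case (add d f g)
  then obtain p q where "\<forall>s. f (v + s *s u) = poly p s" "\<forall>s. g (v + s *s u) = poly q s" by blast
  then show ?case by (intro exI[of _ "p + q"]) simp
next
  case (mult d f e g)
  then obtain p q where "\<forall>s. f (v + s *s u) = poly p s" "\<forall>s. g (v + s *s u) = poly q s" by blast
  then show ?case by (intro exI[of _ "p * q"]) simp
qed

text \<open>A root s of 1 + X q(X) satisfies s q(s) = -1, so neither factor vanishes.\<close>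

lemma poly_nonzero_away_from_0:
  fixes q :: "'k::alg_closed_field poly"
  assumes "poly q 0 \<noteq> 0"
  obtains s where "s \<noteq> 0" "poly q s \<noteq> 0"
proof -
  have "degree (pCons 1 q) > 0" using assms by auto
  then obtain s where s: "poly (pCons 1 q) s = 0" using alg_closed_imp_poly_has_root by blast
  then have "s \<noteq> 0" "poly q s \<noteq> 0" by auto
  then show thesis by (rule that)
qed

section \<open>Basic open sets of the Zariski topology\<close>

definition nonvanishing :: "('k::field tensor4 \<Rightarrow> 'k) \<Rightarrow> 'k tensor4 set set" where
  "nonvanishing f = {L \<in> one_spaces. \<exists>t\<in>L. f t \<noteq> 0}"

text \<open>By homogeneity, \<open>f\<close> vanishes on the whole line as soon as it vanishes at
  the generator.\<close>

lemma span_in_nonvanishing: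
  assumes "homogeneous_poly d f"
  shows "vec.span {v} \<in> nonvanishing f \<longleftrightarrow> vec.span {v} \<in> one_spaces \<and> f v \<noteq> 0"
  using homogeneous_poly_scale[OF assms] vec.span_base[of v "{v}"]
  by (auto simp: nonvanishing_def vec.span_singleton)

lemma openin_zariski_nonvanishing:
  "homogeneous_poly d f \<Longrightarrow> openin zariski_topology (nonvanishing f)"
  unfolding zariski_topology_def nonvanishing_def
  by (rule topology_generated_by_Basis) blast

text \<open>The generating sets are already a base: on a line where \<open>f\<close> and
  \<open>g\<close> are both nonzero, so is their product, which is again homogeneous.\<close>

lemma openin_zariski_base:
  assumes "openin zariski_topology U" "L \<in> U"
  shows "\<exists>d f. homogeneous_poly d f \<and> L \<in> nonvanishing f \<and> nonvanishing f \<subseteq> U"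
proof -
  have "generate_topology_on {nonvanishing f | f. \<exists>d. homogeneous_poly d f} U"
    using assms(1) by (simp only: zariski_topology_def openin_topology_generated_by_iff nonvanishing_def)
  from this assms(2) show ?thesis
  proof (induction arbitrary: L rule: generate_topology_on.induct)
    case Empty
    then show ?case by simp
  next
    case (Int a b)
    then obtain d f e g where f: "homogeneous_poly d f" "L \<in> nonvanishing f" "nonvanishing f \<subseteq> a"
      and g: "homogeneous_poly e g" "L \<in> nonvanishing g" "nonvanishing g \<subseteq> b"
      using Int.IH[of L] Int.prems by blast
    have fg: "homogeneous_poly (d + e) (\<lambda>t. f t * g t)" using f g by (intro homogeneous_poly.mult)
    obtain v where v: "L = vec.span {v}" "L \<in> one_spaces"
      using f(2) by (auto simp: nonvanishing_def one_spaces_def)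
    have "f v \<noteq> 0" "g v \<noteq> 0"
      using f(2) g(2) by (simp_all add: v(1) span_in_nonvanishing[OF f(1)] span_in_nonvanishing[OF g(1)])
    then have "L \<in> nonvanishing (\<lambda>t. f t * g t)"
      using v by (simp add: span_in_nonvanishing[OF fg])
    moreover have "nonvanishing (\<lambda>t. f t * g t) \<subseteq> nonvanishing f \<inter> nonvanishing g"
      by (auto simp: nonvanishing_def)
    ultimately show ?case using fg f(3) g(3) by blast
  next
    case (UN K)
    then obtain k where k: "k \<in> K" "L \<in> k" by blast
    obtain d f where "homogeneous_poly d f" "L \<in> nonvanishing f" "nonvanishing f \<subseteq> k"
      using UN.IH[OF k] by blast
    with k(1) show ?case by blast
  next
    case (Basis s)
    then show ?case by blast
  qed
qed

lemma singular_subset_one_spaces: "singular_one_spaces \<subseteq> one_spaces"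
  by (auto simp: singular_one_spaces_def one_spaces_def)

lemma topspace_singular_variety: "topspace singular_variety = singular_one_spaces"
proof -
  have "nonvanishing (\<lambda>t. 1 :: 'a) = one_spaces"
    by (auto simp: nonvanishing_def one_spaces_def intro: vec.span_base)
  then have "one_spaces \<subseteq> topspace (zariski_topology :: 'a tensor4 set topology)"
    using openin_subset[OF openin_zariski_nonvanishing[OF homogeneous_poly.const[of "1::'a"]]] by simp
  then show ?thesis
    using singular_subset_one_spaces unfolding singular_variety_def topspace_subtopology by blast
qed

text \<open>A basic neighbourhood of the point is given by some \<open>f\<close> with
  \<open>f v\<close> nonzero. Restricted to the line, \<open>f\<close> is a polynomial nonzero at 0,
  hence also at some other parameter, where the line lies in the orbit.\<close>

lemma in_closure_of_line:
  fixes v :: "'k::alg_closed_field tensor4"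
  assumes v: "vec.span {v} \<in> singular_one_spaces"
    and line: "\<And>s. s \<noteq> 0 \<Longrightarrow> vec.span {v + s *s u} \<in> \<Omega>"
    and \<Omega>: "\<Omega> \<subseteq> singular_one_spaces"
  shows "vec.span {v} \<in> singular_variety closure_of \<Omega>"
  unfolding in_closure_of topspace_singular_variety
proof (intro conjI allI impI v)
  fix T assume T: "vec.span {v} \<in> T \<and> openin singular_variety T"
  then obtain U where U: "openin zariski_topology U" "T = U \<inter> singular_one_spaces"
    by (auto simp: singular_variety_def openin_subtopology)
  then obtain d f where f: "homogeneous_poly d f" "vec.span {v} \<in> nonvanishing f" "nonvanishing f \<subseteq> U"
    using openin_zariski_base T by blast
  then have fv: "f v \<noteq> 0" by (simp add: span_in_nonvanishing[OF f(1)])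
  obtain q where q: "\<And>s. f (v + s *s u) = poly q s"
    using homogeneous_poly_line[OF f(1)] by blast
  have "poly q 0 \<noteq> 0" using fv q[of 0] by simp
  then obtain s where s: "s \<noteq> 0" "poly q s \<noteq> 0" by (rule poly_nonzero_away_from_0)
  then have "vec.span {v + s *s u} \<in> \<Omega>" using line by blast
  moreover from this have "vec.span {v + s *s u} \<in> nonvanishing f"
    using s \<Omega> singular_subset_one_spaces by (auto simp: span_in_nonvanishing[OF f(1)] q)
  ultimately show "\<exists>y. y \<in> \<Omega> \<and> y \<in> T" using f(3) U(2) \<Omega> by blast
qed

section \<open>The dense orbit\<close>

definition open_orbit :: "'k::field tensor4 set set" where
  "open_orbit = orbit PGL2 PGL2_act (vec.span {bq 4 0 0 1 0})"

lemma open_orbit_in_orbits: "open_orbit \<in> orbits PGL2 singular_one_spaces PGL2_act"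
  using normal_forms_singular(3) by (auto simp: open_orbit_def orbits_def singular_one_spaces_eq)

lemma open_orbit_subset: "open_orbit \<subseteq> (singular_one_spaces :: 'k::field tensor4 set set)"
proof -
  interpret group_action "PGL2 :: ('k^2^2) set monoid" singular_one_spaces PGL2_act
    by (rule PGL2_group_action)
  show ?thesis using orbits_coverture open_orbit_in_orbits by blast
qed

lemma span_in_open_orbit_iff:
  "t \<noteq> 0 \<Longrightarrow> vec.span {t} \<in> open_orbit \<longleftrightarrow> proj_equiv t (bq 4 0 0 1 0)"
  unfolding open_orbit_def using orbit_PGL2_iff[OF normal_forms_singular(3)] proj_equiv_sym by blast

lemma proj_equiv_nonzero: "proj_equiv s t \<Longrightarrow> t \<noteq> 0 \<Longrightarrow> s \<noteq> 0"
  by (metis proj_equiv_def tensor_map_eq_0_iff vector_mul_eq_0)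

lemma open_orbit_dense:
  assumes nz: "(2::'k::alg_closed_field) \<noteq> 0" "(3::'k) \<noteq> 0"
  shows "is_dense_orbit (open_orbit :: 'k tensor4 set set)"
  unfolding is_dense_orbit_def topspace_singular_variety
proof (intro conjI open_orbit_in_orbits antisym)
  show "singular_variety closure_of open_orbit \<subseteq> (singular_one_spaces :: 'k tensor4 set set)"
    using closure_of_subset_topspace topspace_singular_variety by metis
  \<comment> \<open>It suffices to give a line through the normal form \<open>r\<close>: the matrix
    \<open>A\<close> carries it to a line through a multiple of \<open>t\<close>, staying within the
    same orbits.\<close>
  have degenerate: "vec.span {t} \<in> singular_variety closure_of open_orbit"
    if t: "t \<in> singular_vectors" "proj_equiv t r"
      and line: "\<And>s. s \<noteq> 0 \<Longrightarrow> proj_equiv (r + s *s u) (bq 4 0 0 1 0)" for t r u :: "'k tensor4"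
  proof -
    obtain A c where A: "invertible A" "c \<noteq> 0" "tensor_map A r = c *s t"
      using proj_equiv_sym[OF t(2)] by (auto simp: proj_equiv_def)
    have "vec.span {tensor_map A r} \<in> singular_variety closure_of open_orbit"
    proof (rule in_closure_of_line[OF _ _ open_orbit_subset])
      show "vec.span {tensor_map A r} \<in> singular_one_spaces"
        unfolding A(3) span_scale_eq[OF A(2)] using t by (simp add: singular_one_spaces_eq)
      fix s :: 'k assume "s \<noteq> 0"
      have "proj_equiv (tensor_map A (r + s *s u)) (r + s *s u)"
        by (rule proj_equiv_sym, rule proj_equivI[of A 1]) (simp_all add: A)
      then have eq: "proj_equiv (tensor_map A r + s *s tensor_map A u) (bq 4 0 0 1 0)"
        using line[OF \<open>s \<noteq> 0\<close>] by (auto simp: tensor_map_add tensor_map_scale intro: proj_equiv_trans)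
      moreover from this have "tensor_map A r + s *s tensor_map A u \<noteq> 0"
        by (rule proj_equiv_nonzero) (simp add: bq_eq_0_iff)
      ultimately show "vec.span {tensor_map A r + s *s tensor_map A u} \<in> open_orbit"
        by (simp add: span_in_open_orbit_iff)
    qed
    then show ?thesis by (simp add: A(3) span_scale_eq[OF A(2)])
  qed
  show "(singular_one_spaces :: 'k tensor4 set set) \<subseteq> singular_variety closure_of open_orbit"
  proof
    fix L :: "'k tensor4 set" assume "L \<in> singular_one_spaces"
    then obtain t where t: "t \<in> singular_vectors" "L = vec.span {t}"
      by (auto simp: singular_one_spaces_eq)
    then consider "proj_equiv t (bq 1 0 0 0 0)" | "proj_equiv t (bq 0 1 0 0 0)"
      | "proj_equiv t (bq 4 0 0 1 0)"
      using singular_normal_form[OF nz] by (auto simp: singular_vectors_def)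
    then show "L \<in> singular_variety closure_of open_orbit"
    proof cases
      case 1
      show ?thesis unfolding t(2)
        \<comment> \<open>The line consists of \<open>bq 1 0 0 s 0\<close>.\<close>
        by (rule degenerate[OF t(1) 1, of "bq 0 0 0 1 0"])
          (simp add: bq_scale bq_add proj_equiv_double_form[OF nz])
    next
      case 2
      \<comment> \<open>The swap turns these points into \<open>bq s 0 0 1 0\<close>, again of the
        shape treated by \<open>proj_equiv_double_form\<close>.\<close>
      have "proj_equiv (bq 0 1 0 0 s) (bq 4 0 0 1 0)" if "s \<noteq> 0" for s :: 'k
        using proj_equiv_trans[OF proj_equiv_swap[OF nz] proj_equiv_double_form[OF nz that]] by simp
      then show ?thesis unfolding t(2)
        by (intro degenerate[OF t(1) 2, of "bq 0 0 0 0 1"]) (simp add: bq_scale bq_add)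
    next
      case 3
      then have "L \<in> open_orbit" using t by (simp add: span_in_open_orbit_iff singular_vectors_def)
      then show ?thesis
        using closure_of_subset open_orbit_subset topspace_singular_variety by (metis subsetD)
    qed
  qed
qed

lemma homogeneous_poly_catalecticant: "homogeneous_poly 3 catalecticant"
proof -
  have 3: "homogeneous_poly 3 (\<lambda>t. t $ i * t $ j * t $ k)" for i j k
    using homogeneous_poly.mult[OF homogeneous_poly.mult[OF
        homogeneous_poly.coord[of i] homogeneous_poly.coord[of j]] homogeneous_poly.coord[of k]]
    by (simp add: numeral_3_eq_3)
  have "homogeneous_poly 3 (\<lambda>t. c * (t $ i * t $ j * t $ k))" for c i j k
    using homogeneous_poly.mult[OF homogeneous_poly.const[of c] 3[of i j k]] by simp
  then show ?thesis
    unfolding catalecticant_def Let_def by (intro homogeneous_poly.add 3)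
qed

text \<open>The nonvanishing locus of the catalecticant is open and contains the span of
  \<open>bq 4 0 0 1 0\<close>, so a dense orbit meets it. Among singular points it contains only
  those of \<open>open_orbit\<close>, and orbits that meet coincide.\<close>

lemma dense_orbit_unique:
  assumes nz: "(2::'k::alg_closed_field) \<noteq> 0" "(3::'k) \<noteq> 0"
    and dense: "is_dense_orbit (\<Omega> :: 'k tensor4 set set)"
  shows "\<Omega> = open_orbit"
proof -
  interpret group_action "PGL2 :: ('k^2^2) set monoid" singular_one_spaces PGL2_act
    by (rule PGL2_group_action)
  let ?t = "bq 4 0 0 1 0 :: 'k tensor4"
  let ?U = "nonvanishing catalecticant \<inter> singular_one_spaces :: 'k tensor4 set set"
  have S: "vec.span {?t} \<in> singular_one_spaces"
    unfolding singular_one_spaces_eq by (intro imageI normal_forms_singular)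
  have "(4::'k) \<noteq> 0" using nz by (metis mult_2 mult_eq_0_iff numeral_Bit0)
  then have "vec.span {?t} \<in> ?U"
    using S singular_subset_one_spaces
    by (auto simp: span_in_nonvanishing[OF homogeneous_poly_catalecticant] catalecticant_bq)
  moreover have "openin singular_variety ?U"
    unfolding singular_variety_def openin_subtopology
    using openin_zariski_nonvanishing[OF homogeneous_poly_catalecticant] by blast
  moreover have "vec.span {?t} \<in> singular_variety closure_of \<Omega>"
    using dense S by (simp add: is_dense_orbit_def topspace_singular_variety)
  ultimately obtain L where L: "L \<in> \<Omega>" "L \<in> ?U" by (auto simp: in_closure_of)
  then obtain t where t: "L = vec.span {t}" "t \<in> singular_vectors"
    by (auto simp: singular_one_spaces_eq)
  then have "catalecticant t \<noteq> 0"
    using L by (simp add: span_in_nonvanishing[OF homogeneous_poly_catalecticant])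
  then have "proj_equiv t ?t"
    using singular_normal_form[OF nz] t(2) catalecticant_proj_equiv
    by (auto simp: singular_vectors_def)
  then have "L \<in> open_orbit" using t by (simp add: span_in_open_orbit_iff singular_vectors_def)
  with L show ?thesis
    using disjoint_union[OF _ open_orbit_in_orbits] dense unfolding is_dense_orbit_def by blast
qed

section \<open>Permutations of four points\<close>

text \<open>Conjugation by \<open>g\<close> is the isomorphism. It transfers the computation at one
  representative to every point of its orbit.\<close>

lemma (in group_action) stabilizer_conj_iso:
  assumes x: "x \<in> E" and g: "g \<in> carrier G"
  shows "G\<lparr>carrier := stabilizer G \<phi> x\<rparr> \<cong> G\<lparr>carrier := stabilizer G \<phi> (\<phi> g x)\<rparr>"
proof -
  interpret G: group G using group_hom group_hom.axioms(1) by auto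
  have gx: "\<phi> g x \<in> E" using element_image[OF g x refl] .
  have inv_gx: "\<phi> (inv g) (\<phi> g x) = x" using orbit_sym_aux[OF g x refl] .
  let ?f = "\<lambda>h. g \<otimes> h \<otimes> inv g"
  let ?f' = "\<lambda>h. inv g \<otimes> h \<otimes> g"
  have f: "?f h \<in> stabilizer G \<phi> (\<phi> g x)" if "h \<in> stabilizer G \<phi> x" for h
    using that g x gx by (simp add: stabilizer_def composition_rule inv_gx)
  have f': "?f' h \<in> stabilizer G \<phi> x" if "h \<in> stabilizer G \<phi> (\<phi> g x)" for h
    using that g x gx by (simp add: stabilizer_def composition_rule inv_gx)
  have carr: "h \<in> carrier G" if "h \<in> stabilizer G \<phi> y" for h y
    using that by (simp add: stabilizer_def)
  have cancel: "inv g \<otimes> (g \<otimes> h) = h" "g \<otimes> (inv g \<otimes> h) = h" if "h \<in> carrier G" for h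
    using that g by (simp_all flip: G.m_assoc)
  have "bij_betw ?f (stabilizer G \<phi> x) (stabilizer G \<phi> (\<phi> g x))"
  proof (rule bij_betw_byWitness[where f' = ?f'])
    show "\<forall>h\<in>stabilizer G \<phi> x. ?f' (?f h) = h"
      using g by (auto simp: G.m_assoc cancel dest!: carr)
    show "\<forall>h\<in>stabilizer G \<phi> (\<phi> g x). ?f (?f' h) = h"
      using g by (auto simp: G.m_assoc cancel dest!: carr)
  qed (use f f' in blast)+
  moreover have "?f (h \<otimes> k) = ?f h \<otimes> ?f k" if "h \<in> carrier G" "k \<in> carrier G" for h k
    using that g by (simp add: G.m_assoc cancel)
  ultimately have "?f \<in> iso (G\<lparr>carrier := stabilizer G \<phi> x\<rparr>) (G\<lparr>carrier := stabilizer G \<phi> (\<phi> g x)\<rparr>)"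
    using f carr by (auto simp: iso_def hom_def)
  then show ?thesis by (auto simp: is_iso_def)
qed

section \<open>Generators of the alternating group\<close>

definition three_cycle :: "nat \<Rightarrow> nat" where
  "three_cycle = Transposition.transpose 2 3 \<circ> Transposition.transpose 3 4"

text \<open>Like \<open>three_cycle\<close>, written as a product of two transpositions, which makes
  evenness immediate.\<close>

definition double_transposition :: "nat \<Rightarrow> nat" where
  "double_transposition = Transposition.transpose 1 2 \<circ> Transposition.transpose 3 4"

lemma three_cycle_simps [simp]:
  "three_cycle 1 = 1" "three_cycle (Suc 0) = Suc 0" "three_cycle 2 = 3" "three_cycle 3 = 4"
  "three_cycle 4 = 2"
  by (simp_all add: three_cycle_def Transposition.transpose_def)

lemma double_transposition_simps [simp]:
  "double_transposition 1 = 2" "double_transposition (Suc 0) = 2" "double_transposition 2 = 1"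
  "double_transposition 3 = 4" "double_transposition 4 = 3"
  by (simp_all add: double_transposition_def Transposition.transpose_def)

lemma generators_permute:
  "three_cycle permutes {1..4}" "double_transposition permutes {1..4}"
  by (auto simp: three_cycle_def double_transposition_def intro!: permutes_compose permutes_swap_id)

lemma permutation_swap: "permutation (Transposition.transpose a b)"
  by (simp add: permutation_swap_id)

lemma evenperm_generators:
  assumes "permutation \<pi>"
  shows "evenperm (three_cycle \<circ> \<pi>) \<longleftrightarrow> evenperm \<pi>"
    and "evenperm (double_transposition \<circ> \<pi>) \<longleftrightarrow> evenperm \<pi>"
proof -
  have "evenperm three_cycle" "evenperm double_transposition"
    by (simp_all add: three_cycle_def double_transposition_def evenperm_comp permutation_swap
        evenperm_swap)
  moreover have "permutation three_cycle" "permutation double_transposition"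
    using generators_permute by (auto simp: permutation_permutes)
  ultimately show "evenperm (three_cycle \<circ> \<pi>) \<longleftrightarrow> evenperm \<pi>"
    "evenperm (double_transposition \<circ> \<pi>) \<longleftrightarrow> evenperm \<pi>"
    using assms by (simp_all add: evenperm_comp)
qed

lemma atLeastAtMost_4: "{1..4::nat} = {1, 2, 3, 4}" by auto

text \<open>Left multiplication by the two generators moves every permutation of four points into the
  stabilizer of 1 and 2.\<close>

lemma permutes_4_induct:
  assumes \<pi>: "\<pi> permutes {1..4::nat}"
    and id: "P id" and swap: "P (Transposition.transpose 3 4)"
    and cycle: "\<And>\<pi>. \<pi> permutes {1..4} \<Longrightarrow> P (three_cycle \<circ> \<pi>) \<Longrightarrow> P \<pi>"
    and double: "\<And>\<pi>. \<pi> permutes {1..4} \<Longrightarrow> P (double_transposition \<circ> \<pi>) \<Longrightarrow> P \<pi>"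
  shows "P \<pi>"
proof -
  note perm = permutes_compose[OF _ generators_permute(1)] permutes_compose[OF _ generators_permute(2)]
  have range: "\<rho> i = 1 \<or> \<rho> i = 2 \<or> \<rho> i = 3 \<or> \<rho> i = 4"
    if "\<rho> permutes {1..4}" "i \<in> {1..4}" for \<rho> :: "nat \<Rightarrow> nat" and i
    using permutes_in_image[OF that(1), of i] that(2) by (auto simp: atLeastAtMost_4)
  have fix12: "P \<rho>" if \<rho>: "\<rho> permutes {1..4}" and 12: "\<rho> 1 = 1" "\<rho> 2 = 2" for \<rho>
  proof -
    have inj: "\<rho> i = \<rho> j \<longleftrightarrow> i = j" for i j using permutes_inj[OF \<rho>] by (auto dest: injD)
    have out: "\<rho> i = i" if "i \<notin> {1, 2, 3, 4}" for i
      using permutes_not_in[OF \<rho>] that unfolding atLeastAtMost_4 by blast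
    have 3: "\<rho> 3 = 3 \<or> \<rho> 3 = 4" using range[OF \<rho>, of 3] inj[of 3 1] inj[of 3 2] 12 by auto
    have 4: "\<rho> 4 = 3 \<or> \<rho> 4 = 4" using range[OF \<rho>, of 4] inj[of 4 1] inj[of 4 2] 12 by auto
    have "\<rho> 3 \<noteq> \<rho> 4" by (simp add: inj)
    with 3 4 consider "\<rho> 3 = 3" "\<rho> 4 = 4" | "\<rho> 3 = 4" "\<rho> 4 = 3" by auto
    then show ?thesis
    proof cases
      case 1
      have "\<rho> i = i" for i
        using 1 12 out[of i] by (cases "i \<in> {1, 2, 3, 4}") auto
      then show ?thesis using id by (simp add: fun_eq_iff[of \<rho> id, THEN iffD2])
    next
      case 2
      have "\<rho> i = Transposition.transpose 3 4 i" for i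
        using 2 12 out[of i] by (cases "i \<in> {1, 2, 3, 4}") (auto simp: Transposition.transpose_def)
      then have "\<rho> = Transposition.transpose 3 4" by (rule ext)
      then show ?thesis using swap by simp
    qed
  qed
  have fix1: "P \<rho>" if \<rho>: "\<rho> permutes {1..4}" and 1: "\<rho> 1 = 1" for \<rho>
  proof -
    have 2: "\<rho> 2 = 2 \<or> \<rho> 2 = 3 \<or> \<rho> 2 = 4"
      using range[OF \<rho>, of 2] permutes_inj[OF \<rho>] 1 by (auto dest: injD[of _ 2 1])
    \<comment> \<open>\<open>three_cycle\<close> fixes 1, sends 4 to 2 and 3 to 4, so the value at 2
      becomes 2 after one or two applications.\<close>
    have c4: "P \<rho>" if "\<rho> permutes {1..4}" "\<rho> 1 = 1" "\<rho> 2 = 4" for \<rho>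
      by (rule cycle[OF that(1)], rule fix12[OF perm(1)]) (use that in simp_all)
    have c3: "P \<rho>" if "\<rho> permutes {1..4}" "\<rho> 1 = 1" "\<rho> 2 = 3" for \<rho>
      by (rule cycle[OF that(1)], rule c4[OF perm(1)]) (use that in simp_all)
    show ?thesis using 2 c3[OF \<rho> 1] c4[OF \<rho> 1] fix12[OF \<rho> 1] by blast
  qed
  \<comment> \<open>The value at 1 is led along 3, 4, 2, 1: \<open>three_cycle\<close> makes the
    first two moves, \<open>double_transposition\<close> the last.\<close>
  have c2: "P \<rho>" if "\<rho> permutes {1..4}" "\<rho> 1 = 2" for \<rho>
    by (rule double[OF that(1)], rule fix1[OF perm(2)]) (use that in simp_all)
  have c4: "P \<rho>" if "\<rho> permutes {1..4}" "\<rho> 1 = 4" for \<rho>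
    by (rule cycle[OF that(1)], rule c2[OF perm(1)]) (use that in simp_all)
  have c3: "P \<rho>" if "\<rho> permutes {1..4}" "\<rho> 1 = 3" for \<rho>
    by (rule cycle[OF that(1)], rule c4[OF perm(1)]) (use that in simp_all)
  show ?thesis
    using range[OF \<pi>, of 1] fix1[OF \<pi>] c2[OF \<pi>] c3[OF \<pi>] c4[OF \<pi>] by auto
qed

section \<open>The stabilizer of the equianharmonic quartic\<close>

text \<open>The preimage in \<open>GL2\<close> of the stabilizer of the 1-space; it contains all
  nonzero scalars.\<close>

definition form_stabilizer :: "('k::field ^ 2 ^ 2) set" where
  "form_stabilizer = {A. invertible A \<and> (\<exists>c. c \<noteq> 0 \<and> tensor_map A (bq 4 0 0 1 0) = c *s bq 4 0 0 1 0)}"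

text \<open>The form \<open>4 y (y\<^sup>3 - x\<^sup>3)\<close> attached to \<open>bq 4 0 0 1 0\<close> vanishes at infinity and at the
  cube roots of unity, and \<open>w\<close> is a primitive one.\<close>

locale equianharmonic =
  fixes w :: "'k::field"
  assumes two: "(2::'k) \<noteq> 0" and three: "(3::'k) \<noteq> 0" and w: "w ^ 2 + w + 1 = 0"
begin

lemma w_cube: "w ^ 3 = 1" using w by algebra

lemma w_nontrivial: "w \<noteq> 0" "w \<noteq> 1" "w ^ 2 \<noteq> 0" "w ^ 2 \<noteq> 1" "w ^ 2 \<noteq> w"
proof -
  show "w \<noteq> 0" using w by auto
  then show "w ^ 2 \<noteq> 0" by simp
  show 1: "w \<noteq> 1" using w three by auto
  show "w ^ 2 \<noteq> w"
  proof
    assume "w ^ 2 = w"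
    then have "w * (w - 1) = 0" by (simp add: power2_eq_square right_diff_distrib)
    then show False using 1 \<open>w \<noteq> 0\<close> by simp
  qed
  show "w ^ 2 \<noteq> 1"
  proof
    assume "w ^ 2 = 1"
    then have "w = 1" using w_cube by algebra
    then show False using 1 by simp
  qed
qed

text \<open>The label 1 stands for infinity, and 2, 3, 4 for the cube roots of unity 1, w, w^2. The
  last branch also covers labels outside \<open>{1..4}\<close>, so \<open>root_nonzero\<close> holds
  for every label.\<close>

definition root_vec :: "nat \<Rightarrow> 'k ^ 2" where
  "root_vec i = (if i = 1 then vector [1, 0] else if i = 2 then vector [1, 1]
     else if i = 3 then vector [w, 1] else vector [w ^ 2, 1])"

lemma root_simps:
  "root_vec 1 $ 1 = 1" "root_vec 1 $ 2 = 0" "root_vec (Suc 0) $ 1 = 1" "root_vec (Suc 0) $ 2 = 0"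
  "root_vec 2 $ 1 = 1" "root_vec 2 $ 2 = 1"
  "root_vec 3 $ 1 = w" "root_vec 3 $ 2 = 1" "root_vec 4 $ 1 = w ^ 2" "root_vec 4 $ 2 = 1"
  by (simp_all add: root_vec_def)

lemma root_nonzero: "root_vec i \<noteq> 0"
  by (auto simp: root_vec_def vec_eq_iff forall_2)

lemma root_proportional_iff:
  assumes "i \<in> {1..4}" "j \<in> {1..4}" "a \<noteq> 0" "b \<noteq> 0" "a *s root_vec i = b *s root_vec j"
  shows "i = j"
proof -
  have e: "a * root_vec i $ 1 = b * root_vec j $ 1" "a * root_vec i $ 2 = b * root_vec j $ 2"
    using assms(5) by (simp_all add: vec_eq_iff)
  from assms(1,2) have "i \<in> {1, 2, 3, 4}" "j \<in> {1, 2, 3, 4}" by auto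
  then show ?thesis
    using e assms(3,4) w_nontrivial by (elim insertE emptyE; simp add: root_simps)
qed

lemma quartic_form: "quartic (bq 4 0 0 1 0) v = 4 * (v $ 2 * (v $ 2 ^ 3 - v $ 1 ^ 3))"
  by (simp add: quartic_bq algebra_simps power3_eq_cube power4_eq_xxxx)

lemma quartic_form_eq_0:
  assumes "v \<noteq> 0" "quartic (bq 4 0 0 1 0) v = 0"
  obtains i c where "i \<in> {1..4}" "c \<noteq> 0" "v = c *s root_vec i"
proof -
  have "2 * (2 * (v $ 2 * (v $ 2 ^ 3 - v $ 1 ^ 3))) = 0"
    using assms(2) unfolding quartic_form by simp
  then have "v $ 2 * (v $ 2 ^ 3 - v $ 1 ^ 3) = 0" using two unfolding mult_eq_0_iff by auto
  moreover have "v $ 2 ^ 3 - v $ 1 ^ 3 =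
      (v $ 2 - v $ 1) * ((v $ 1 - w * v $ 2) * (v $ 1 - w ^ 2 * v $ 2))"
    using w by algebra
  ultimately have "v $ 2 = 0 \<or> v $ 2 - v $ 1 = 0 \<or> v $ 1 - w * v $ 2 = 0 \<or> v $ 1 - w ^ 2 * v $ 2 = 0"
    by (simp only: mult_eq_0_iff)
  then consider "v $ 2 = 0" | "v $ 2 \<noteq> 0" "v $ 1 = v $ 2" | "v $ 2 \<noteq> 0" "v $ 1 = w * v $ 2"
    | "v $ 2 \<noteq> 0" "v $ 1 = w ^ 2 * v $ 2"
    by (metis eq_iff_diff_eq_0)
  then show thesis
  proof cases
    case 1
    then show thesis using assms(1)
      by (intro that[of 1 "v $ 1"]) (auto simp: vec_eq_iff forall_2 root_simps)
  next
    case 2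
    then show thesis by (intro that[of 2 "v $ 2"]) (auto simp: vec_eq_iff forall_2 root_simps)
  next
    case 3
    then show thesis by (intro that[of 3 "v $ 2"]) (auto simp: vec_eq_iff forall_2 root_simps)
  next
    case 4
    then show thesis by (intro that[of 4 "v $ 2"]) (auto simp: vec_eq_iff forall_2 root_simps)
  qed
qed

section \<open>The permutation of the roots induced by a matrix\<close>

definition permutes_roots :: "'k ^ 2 ^ 2 \<Rightarrow> (nat \<Rightarrow> nat) \<Rightarrow> bool" where
  "permutes_roots A \<pi> \<longleftrightarrow>
     \<pi> permutes {1..4} \<and> (\<forall>i\<in>{1..4}. \<exists>c. c \<noteq> 0 \<and> A *v root_vec i = c *s root_vec (\<pi> i))"

lemma quartic_root_form: "i \<in> {1..4} \<Longrightarrow> quartic (bq 4 0 0 1 0) (root_vec i) = 0"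
proof -
  assume "i \<in> {1..4}"
  then have "i \<in> {1, 2, 3, 4}" by auto
  moreover have "(w ^ 2) ^ 3 = 1" using w_cube by algebra
  ultimately show ?thesis
    unfolding quartic_form by (elim insertE emptyE; simp add: root_simps w_cube)
qed

lemma mult_vec_nonzero:
  fixes A :: "'k ^ 2 ^ 2"
  assumes "invertible A" "v \<noteq> 0"
  shows "A *v v \<noteq> 0"
  using assms by (metis invertible_def matrix_vector_mul_assoc matrix_vector_mul_lid
        matrix_vector_mult_0_right)

lemma mult_scale_vec: "A *v (c *s v) = c *s (A *v v)" for A :: "'k ^ 2 ^ 2"
  by (simp add: vec_eq_iff matrix_vector_mult_def sum_2 forall_2 algebra_simps)

text \<open>By \<open>quartic_map\<close> the matrix sends roots to roots, and by invertibility
  distinct roots stay distinct.\<close>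

lemma form_stabilizer_permutes_roots:
  assumes "A \<in> form_stabilizer"
  shows "\<exists>\<pi>. permutes_roots A \<pi>"
proof -
  obtain c where A: "invertible A" "c \<noteq> 0" "tensor_map A (bq 4 0 0 1 0) = c *s bq 4 0 0 1 0"
    using assms by (auto simp: form_stabilizer_def)
  have "\<exists>j d. j \<in> {1..4} \<and> d \<noteq> 0 \<and> A *v root_vec i = d *s root_vec j" if i: "i \<in> {1..4}" for i
  proof -
    have "quartic (c *s bq 4 0 0 1 0) (A *v root_vec i) = 0"
      unfolding A(3)[symmetric] quartic_map quartic_root_form[OF i] by simp
    then have "c * quartic (bq 4 0 0 1 0) (A *v root_vec i) = 0"
      by (simp add: bq_scale quartic_bq algebra_simps)
    then have "quartic (bq 4 0 0 1 0) (A *v root_vec i) = 0" using A(2) by simp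
    then show ?thesis
      using quartic_form_eq_0[OF mult_vec_nonzero[OF A(1) root_nonzero]] by metis
  qed
  then obtain f where f: "\<And>i. i \<in> {1..4} \<Longrightarrow> f i \<in> {1..4} \<and> (\<exists>d. d \<noteq> 0 \<and> A *v root_vec i = d *s root_vec (f i))"
    by metis
  let ?\<pi> = "\<lambda>i. if i \<in> {1..4} then f i else i"
  have inj: "inj_on f {1..4}"
  proof (rule inj_onI)
    fix i j :: nat assume ij: "i \<in> {1..4}" "j \<in> {1..4}" "f i = f j"
    obtain d e where d: "d \<noteq> 0" "A *v root_vec i = d *s root_vec (f i)"
      and e: "e \<noteq> 0" "A *v root_vec j = e *s root_vec (f i)"
      using f[OF ij(1)] f[OF ij(2)] ij(3) by auto
    \<comment> \<open>If two roots have the same image line, the combination cancelling their images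
      is killed by \<open>A\<close>, so the roots are proportional.\<close>
    have "A *v (e *s root_vec i - d *s root_vec j) = 0"
      by (simp add: matrix_vector_mult_diff_distrib mult_scale_vec d e mult.commute)
    then have "e *s root_vec i = d *s root_vec j" using mult_vec_nonzero[OF A(1), of "e *s root_vec i - d *s root_vec j"] by auto
    then show "i = j" using root_proportional_iff ij d e by blast
  qed
  have "?\<pi> permutes {1..4}"
  proof (rule bij_imp_permutes)
    have "f ` {1..4} = {1..4}" using f by (intro endo_inj_surj[OF _ _ inj]) auto
    then have "bij_betw f {1..4} {1..4}" using inj by (simp add: bij_betw_def)
    then show "bij_betw ?\<pi> {1..4} {1..4}" by (rule bij_betw_cong[THEN iffD1, rotated]) simp
  qed auto
  then show ?thesis using f by (auto simp: permutes_roots_def)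
qed

text \<open>The roots are pairwise non-proportional, and outside \<open>{1..4}\<close> both
  permutations are the identity.\<close>

lemma permutes_roots_unique:
  assumes "permutes_roots A \<pi>" "permutes_roots A \<rho>"
  shows "\<pi> = \<rho>"
proof
  fix i
  show "\<pi> i = \<rho> i"
  proof (cases "i \<in> {1..4}")
    case True
    then obtain c d where "c \<noteq> 0" "A *v root_vec i = c *s root_vec (\<pi> i)" "d \<noteq> 0" "A *v root_vec i = d *s root_vec (\<rho> i)"
      using assms unfolding permutes_roots_def by blast
    moreover have "\<pi> i \<in> {1..4}" "\<rho> i \<in> {1..4}"
      using assms True by (simp_all only: permutes_roots_def permutes_in_image)
    ultimately show ?thesis using root_proportional_iff by metis
  next
    case False
    then show ?thesis
      using assms permutes_not_in unfolding permutes_roots_def by metis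
  qed
qed

lemma permutes_roots_mult:
  assumes "permutes_roots A \<pi>" "permutes_roots B \<rho>"
  shows "permutes_roots (A ** B) (\<pi> \<circ> \<rho>)"
  unfolding permutes_roots_def
proof (intro conjI ballI)
  show "\<pi> \<circ> \<rho> permutes {1..4}" using assms by (auto simp: permutes_roots_def intro: permutes_compose)
  fix i :: nat assume i: "i \<in> {1..4}"
  then obtain d where d: "d \<noteq> 0" "B *v root_vec i = d *s root_vec (\<rho> i)"
    using assms(2) unfolding permutes_roots_def by blast
  have "\<rho> i \<in> {1..4}" using assms i by (simp only: permutes_roots_def permutes_in_image)
  then obtain c where c: "c \<noteq> 0" "A *v root_vec (\<rho> i) = c *s root_vec (\<pi> (\<rho> i))"
    using assms(1) unfolding permutes_roots_def by blast
  show "\<exists>c. c \<noteq> 0 \<and> (A ** B) *v root_vec i = c *s root_vec ((\<pi> \<circ> \<rho>) i)"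
    by (rule exI[of _ "d * c"])
      (simp add: c d mult_scale_vec flip: matrix_vector_mul_assoc)
qed

lemma permutes_roots_matrix2:
  assumes "\<pi> permutes {1..4}"
    and "\<And>i. i \<in> {1, 2, 3, 4} \<Longrightarrow>
      \<exists>k. k \<noteq> 0 \<and> a * root_vec i $ 1 + b * root_vec i $ 2 = k * root_vec (\<pi> i) $ 1
        \<and> c * root_vec i $ 1 + d * root_vec i $ 2 = k * root_vec (\<pi> i) $ 2"
  shows "permutes_roots (matrix2 a b c d) \<pi>"
  using assms unfolding permutes_roots_def atLeastAtMost_4
  by (simp only: vec_eq_iff forall_2 matrix2_mult_vec vector_smult_component) simp

text \<open>As Moebius maps, the two matrices are z -> w z and z -> (z + 2) / (z - 1). The first
  fixes infinity and rotates the cube roots of unity; the second exchanges infinity with 1 and w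
  with w^2.\<close>

abbreviation "cycle_matrix \<equiv> matrix2 w 0 0 1"
abbreviation "double_matrix \<equiv> matrix2 1 2 1 (-1 :: 'k)"

lemma cycle_matrix:
  "cycle_matrix \<in> form_stabilizer" "permutes_roots cycle_matrix three_cycle"
proof -
  have "tensor_map cycle_matrix (bq 4 0 0 1 0) = bq (w * 4) 0 0 w 0"
  proof (rule tensor_map_matrix2[OF two three])
    fix x y
    have "w * 4 * y ^ 4 - 4 * (w * ((w * x) ^ 3 * y)) = w ^ 4 * (4 * y ^ 4 - 4 * (x ^ 3 * y))"
      using w_cube by algebra
    then show "w * 4 * (0 * x + 1 * y) ^ 4 - 4 * (0 * ((w * x + 0 * y) * (0 * x + 1 * y) ^ 3))
        + 6 * (0 * ((w * x + 0 * y) ^ 2 * (0 * x + 1 * y) ^ 2))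
        - 4 * (w * ((w * x + 0 * y) ^ 3 * (0 * x + 1 * y))) + 0 * (w * x + 0 * y) ^ 4
      = (w * 1 - 0 * 0) ^ 4 * (4 * y ^ 4 - 4 * (0 * (x * y ^ 3)) + 6 * (0 * (x ^ 2 * y ^ 2))
        - 4 * (1 * (x ^ 3 * y)) + 0 * x ^ 4)"
      by simp
  qed (simp add: w_nontrivial)
  then show "cycle_matrix \<in> form_stabilizer"
    using w_nontrivial(1) by (auto simp: form_stabilizer_def invertible_matrix2 bq_scale intro!: exI[of _ w])
  show "permutes_roots cycle_matrix three_cycle"
  proof (rule permutes_roots_matrix2[OF generators_permute(1)])
    fix i :: nat assume "i \<in> {1, 2, 3, 4}"
    then show "\<exists>k. k \<noteq> 0 \<and> w * root_vec i $ 1 + 0 * root_vec i $ 2 = k * root_vec (three_cycle i) $ 1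
        \<and> 0 * root_vec i $ 1 + 1 * root_vec i $ 2 = k * root_vec (three_cycle i) $ 2"
      using w_nontrivial w_cube
      by (elim insertE emptyE) (auto simp: root_simps power2_eq_square power3_eq_cube mult_ac)
  qed
qed

lemma double_matrix:
  "double_matrix \<in> form_stabilizer" "permutes_roots double_matrix double_transposition"
proof -
  have 9: "(9::'k) \<noteq> 0"
  proof
    assume "(9::'k) = 0"
    then have "3 * 3 = (0::'k)" by simp
    then show False using three unfolding mult_eq_0_iff by simp
  qed
  \<comment> \<open>The form is multiplied by 9. The determinant is -3, whose fourth power is the 81
    below.\<close>
  have "tensor_map double_matrix (bq 4 0 0 1 0) = bq 36 0 0 9 0"
  proof (rule tensor_map_matrix2[OF two three])
    fix x y :: 'k
    have "36 * (x - y) ^ 4 - 4 * (9 * ((x + 2 * y) ^ 3 * (x - y))) = 81 * (4 * y ^ 4 - 4 * (x ^ 3 * y))"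
      by algebra
    then show "36 * (1 * x + - 1 * y) ^ 4 - 4 * (0 * ((1 * x + 2 * y) * (1 * x + - 1 * y) ^ 3))
        + 6 * (0 * ((1 * x + 2 * y) ^ 2 * (1 * x + - 1 * y) ^ 2))
        - 4 * (9 * ((1 * x + 2 * y) ^ 3 * (1 * x + - 1 * y))) + 0 * (1 * x + 2 * y) ^ 4
      = (1 * - 1 - 2 * 1) ^ 4 * (4 * y ^ 4 - 4 * (0 * (x * y ^ 3)) + 6 * (0 * (x ^ 2 * y ^ 2))
        - 4 * (1 * (x ^ 3 * y)) + 0 * x ^ 4)"
      by simp
  qed (use three in simp)
  then show "double_matrix \<in> form_stabilizer"
    using three 9 by (auto simp: form_stabilizer_def invertible_matrix2 bq_scale intro!: exI[of _ 9])
  show "permutes_roots double_matrix double_transposition"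
  proof (rule permutes_roots_matrix2[OF generators_permute(2)])
    fix i :: nat assume i: "i \<in> {1, 2, 3, 4}"
    \<comment> \<open>These equations exchange w and w^2; the scalars \<open>k\<close> at these two
      roots are \<open>w - 1\<close> and \<open>w ^ 2 - 1\<close>.\<close>
    have "w + 2 = (w - 1) * w ^ 2" "w ^ 2 + 2 = (w ^ 2 - 1) * w" using w by algebra+
    with i show "\<exists>k. k \<noteq> 0 \<and> 1 * root_vec i $ 1 + 2 * root_vec i $ 2 = k * root_vec (double_transposition i) $ 1
        \<and> 1 * root_vec i $ 1 + - 1 * root_vec i $ 2 = k * root_vec (double_transposition i) $ 2"
      using w_nontrivial three
      by (elim insertE emptyE) (auto simp: root_simps)
  qed
qed

lemma not_permutes_roots_transposition: "\<not> permutes_roots A (Transposition.transpose 3 4)"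
proof
  define a b c d where "a = A $ 1 $ 1" and "b = A $ 1 $ 2" and "c = A $ 2 $ 1" and "d = A $ 2 $ 2"
  assume R: "permutes_roots A (Transposition.transpose 3 4)"
  have E: "\<exists>k. k \<noteq> 0 \<and> a * root_vec i $ 1 + b * root_vec i $ 2 = k * root_vec (Transposition.transpose 3 4 i) $ 1
      \<and> c * root_vec i $ 1 + d * root_vec i $ 2 = k * root_vec (Transposition.transpose 3 4 i) $ 2" if "i \<in> {1..4}" for i
    using R that unfolding permutes_roots_def a_def b_def c_def d_def
    by (auto simp: vec_eq_iff forall_2 matrix_vector_mult_def sum_2)
  have c: "c = 0" using E[of 1] by (auto simp: root_simps)
  have d: "d \<noteq> 0" "a + b = d" using E[of 2] c by (auto simp: root_simps)
  have 3: "a * w + b = d * w ^ 2" using E[of 3] c by (auto simp: root_simps)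
  have 4: "a * w ^ 2 + b = d * w" using E[of 4] c by (auto simp: root_simps)
  \<comment> \<open>Subtracting the two equations gives a = -d, hence b = 2d. The equation at w
    becomes d (w^2 + w - 2) = 0, that is, 3d = 0.\<close>
  have "(a + d) * (w ^ 2 - w) = 0" using 3 4 by algebra
  then have "a = - d" using w_nontrivial by (simp add: eq_neg_iff_add_eq_0)
  then have "3 * d = 0" using d 3 w by algebra
  then show False using d three by simp
qed

text \<open>A Moebius map fixing the three points infinity, 1 and w is the identity. This is the
  faithfulness of the action on the roots.\<close>

lemma permutes_roots_id_iff:
  assumes "invertible A"
  shows "permutes_roots A id \<longleftrightarrow> A \<in> scalar_matrices"
proof
  define a b c d where "a = A $ 1 $ 1" and "b = A $ 1 $ 2" and "c = A $ 2 $ 1" and "d = A $ 2 $ 2"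
  assume R: "permutes_roots A id"
  have E: "\<exists>k. k \<noteq> 0 \<and> a * root_vec i $ 1 + b * root_vec i $ 2 = k * root_vec i $ 1
      \<and> c * root_vec i $ 1 + d * root_vec i $ 2 = k * root_vec i $ 2" if "i \<in> {1..4}" for i
    using R that unfolding permutes_roots_def a_def b_def c_def d_def
    by (auto simp: vec_eq_iff forall_2 matrix_vector_mult_def sum_2)
  have c: "c = 0" using E[of 1] by (auto simp: root_simps)
  have d: "d \<noteq> 0" "a + b = d" using E[of 2] c by (auto simp: root_simps)
  have 3: "a * w + b = d * w" using E[of 3] c by (auto simp: root_simps)
  have "b * (w - 1) = 0" using d 3 by algebra
  then have "b = 0" using w_nontrivial by simp
  with c d have "A = mat d"
    by (simp add: vec_eq_iff forall_2 mat_def a_def b_def c_def d_def)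
  then show "A \<in> scalar_matrices" using d by (auto simp: scalar_matrices_def)
next
  assume "A \<in> scalar_matrices"
  then obtain c where "c \<noteq> 0" "A = mat c" by (auto simp: scalar_matrices_def)
  moreover have "mat c *v v = c *s v" for v :: "'k ^ 2"
    by (simp add: vec_eq_iff forall_2 mat_def matrix_vector_mult_def sum_2)
  ultimately show "permutes_roots A id" by (auto simp: permutes_roots_def permutes_id)
qed

lemma form_stabilizer_invertible: "A \<in> form_stabilizer \<Longrightarrow> invertible (A :: 'k ^ 2 ^ 2)"
  by (simp add: form_stabilizer_def)

lemma form_stabilizer_mult:
  assumes "A \<in> form_stabilizer" "B \<in> form_stabilizer"
  shows "A ** B \<in> (form_stabilizer :: ('k ^ 2 ^ 2) set)"
proof -
  let ?t = "bq 4 0 0 1 0 :: 'k tensor4"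
  obtain c d where "c \<noteq> 0" "tensor_map A ?t = c *s ?t" "d \<noteq> 0" "tensor_map B ?t = d *s ?t"
    using assms by (auto simp: form_stabilizer_def)
  then have "d * c \<noteq> 0" "tensor_map (A ** B) ?t = (d * c) *s ?t"
    by (simp_all add: tensor_map_mult tensor_map_scale)
  then show ?thesis using assms unfolding form_stabilizer_def by (blast intro: invertible_mult)
qed

lemma form_stabilizer_left_inverse:
  fixes A B :: "'k ^ 2 ^ 2"
  assumes A: "A \<in> form_stabilizer" and B: "B ** A = mat 1" "A ** B = mat 1"
  shows "B \<in> form_stabilizer"
proof -
  let ?t = "bq 4 0 0 1 0 :: 'k tensor4"
  obtain c where c: "c \<noteq> 0" "tensor_map A ?t = c *s ?t"
    using A by (auto simp: form_stabilizer_def)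
  have "?t = tensor_map B (c *s ?t)"
    by (simp flip: c(2) tensor_map_mult add: B tensor_map_mat)
  then have "inverse c *s ?t = inverse c *s (c *s tensor_map B ?t)"
    by (simp add: tensor_map_scale)
  then have "tensor_map B ?t = inverse c *s ?t" using c(1) by simp
  moreover have "invertible B" using B by (auto simp: invertible_def)
  ultimately show ?thesis
    using c(1) nonzero_imp_inverse_nonzero unfolding form_stabilizer_def by blast
qed

lemma form_stabilizer_subgroup: "subgroup form_stabilizer (GL2 :: ('k ^ 2 ^ 2) monoid)"
proof -
  interpret group "GL2 :: ('k ^ 2 ^ 2) monoid" by (rule GL2_group)
  show ?thesis
  proof (rule subgroupI)
    show "form_stabilizer \<subseteq> carrier (GL2 :: ('k ^ 2 ^ 2) monoid)"
      by (auto simp: GL2_simps form_stabilizer_invertible)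
    show "form_stabilizer \<noteq> ({} :: ('k ^ 2 ^ 2) set)" using cycle_matrix(1) by blast
    fix A :: "'k ^ 2 ^ 2" assume A: "A \<in> form_stabilizer"
    then have "A \<in> carrier GL2" by (simp add: GL2_simps form_stabilizer_invertible)
    then have "inv\<^bsub>GL2\<^esub> A ** A = mat 1" "A ** inv\<^bsub>GL2\<^esub> A = mat 1"
      using l_inv[of A] r_inv[of A] by (simp_all add: GL2_simps)
    with A show "inv\<^bsub>GL2\<^esub> A \<in> form_stabilizer" by (rule form_stabilizer_left_inverse)
  qed (simp add: GL2_simps form_stabilizer_mult)
qed

text \<open>Multiplying by \<open>M\<close>, or by its inverse, passes between matrices inducing
  \<pi> and \<sigma> \<circ> \<pi>. It supplies the induction steps for
  \<open>form_stabilizer_evenperm\<close>.\<close>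

lemma permutes_roots_cancel:
  assumes M: "M \<in> form_stabilizer" "permutes_roots M \<sigma>" and \<pi>: "\<pi> permutes {1..4}"
  shows "(\<exists>A\<in>form_stabilizer. permutes_roots A (\<sigma> \<circ> \<pi>)) \<longleftrightarrow>
    (\<exists>A\<in>form_stabilizer. permutes_roots A \<pi>)"
proof
  assume "\<exists>A\<in>form_stabilizer. permutes_roots A \<pi>"
  then show "\<exists>A\<in>form_stabilizer. permutes_roots A (\<sigma> \<circ> \<pi>)"
    using M form_stabilizer_mult permutes_roots_mult by blast
next
  assume "\<exists>A\<in>form_stabilizer. permutes_roots A (\<sigma> \<circ> \<pi>)"
  then obtain A where A: "A \<in> form_stabilizer" "permutes_roots A (\<sigma> \<circ> \<pi>)" by blast
  obtain N where N: "M ** N = mat 1" "N ** M = mat 1"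
    using form_stabilizer_invertible[OF M(1)] by (auto simp: invertible_def)
  then have NA: "N ** A \<in> form_stabilizer"
    by (intro form_stabilizer_mult form_stabilizer_left_inverse[OF M(1)] A)
  \<comment> \<open>\<open>N ** A\<close> induces some permutation; applying \<sigma> and using
    uniqueness identifies it with \<pi>.\<close>
  then obtain \<rho> where \<rho>: "permutes_roots (N ** A) \<rho>" using form_stabilizer_permutes_roots by blast
  have "M ** (N ** A) = A" by (simp add: matrix_mul_assoc N)
  then have "permutes_roots A (\<sigma> \<circ> \<rho>)" using permutes_roots_mult[OF M(2) \<rho>] by simp
  then have "\<sigma> \<circ> \<rho> = \<sigma> \<circ> \<pi>" using A(2) permutes_roots_unique by blast
  moreover have "inj \<sigma>" using M(2) permutes_inj by (auto simp: permutes_roots_def)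
  ultimately have "\<rho> = \<pi>" by (simp add: fun_eq_iff inj_eq)
  with \<rho> NA show "\<exists>A\<in>form_stabilizer. permutes_roots A \<pi>" by blast
qed

text \<open>Both sides are unchanged under left multiplication by the two generators, so
  \<open>permutes_4_induct\<close> leaves the identity, where both hold, and one transposition,
  where both fail.\<close>

lemma form_stabilizer_evenperm:
  assumes "\<pi> permutes {1..4}"
  shows "(\<exists>A\<in>form_stabilizer. permutes_roots A \<pi>) \<longleftrightarrow> evenperm \<pi>"
  using assms
proof (rule permutes_4_induct)
  have "mat 1 \<in> (form_stabilizer :: ('k ^ 2 ^ 2) set)"
    using form_stabilizer_subgroup subgroup.one_closed by (fastforce simp: GL2_simps)
  moreover have "permutes_roots (mat 1) id"
    by (subst permutes_roots_id_iff) (auto simp: invertible_mat scalar_matrices_def)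
  ultimately show "(\<exists>A\<in>form_stabilizer. permutes_roots A id) \<longleftrightarrow> evenperm id"
    by (auto simp: evenperm_id)
  show "(\<exists>A\<in>form_stabilizer. permutes_roots A (Transposition.transpose 3 4)) \<longleftrightarrow>
      evenperm (Transposition.transpose 3 (4::nat))"
    using not_permutes_roots_transposition by (simp add: evenperm_swap)
next
  fix \<pi> :: "nat \<Rightarrow> nat"
  assume \<pi>: "\<pi> permutes {1..4}"
  then have perm: "permutation \<pi>" by (auto simp: permutation_permutes)
  show "(\<exists>A\<in>form_stabilizer. permutes_roots A \<pi>) \<longleftrightarrow> evenperm \<pi>"
    if "(\<exists>A\<in>form_stabilizer. permutes_roots A (three_cycle \<circ> \<pi>)) \<longleftrightarrow> evenperm (three_cycle \<circ> \<pi>)"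
    using that unfolding permutes_roots_cancel[OF cycle_matrix \<pi>] evenperm_generators[OF perm] .
  show "(\<exists>A\<in>form_stabilizer. permutes_roots A \<pi>) \<longleftrightarrow> evenperm \<pi>"
    if "(\<exists>A\<in>form_stabilizer. permutes_roots A (double_transposition \<circ> \<pi>)) \<longleftrightarrow>
      evenperm (double_transposition \<circ> \<pi>)"
    using that unfolding permutes_roots_cancel[OF double_matrix \<pi>] evenperm_generators[OF perm] .
qed

section \<open>The isomorphism with the alternating group\<close>

definition root_perm :: "'k ^ 2 ^ 2 \<Rightarrow> nat \<Rightarrow> nat" where
  "root_perm A = (THE \<pi>. permutes_roots A \<pi>)"

lemma root_perm_eq: "permutes_roots A \<pi> \<Longrightarrow> root_perm A = \<pi>"
  unfolding root_perm_def by (rule the_equality) (auto intro: permutes_roots_unique)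

lemma permutes_roots_root_perm: "A \<in> form_stabilizer \<Longrightarrow> permutes_roots A (root_perm A)"
  using form_stabilizer_permutes_roots root_perm_eq by metis

lemma scalar_matrices_subset_form_stabilizer:
  "scalar_matrices \<subseteq> (form_stabilizer :: ('k ^ 2 ^ 2) set)"
proof
  fix A :: "'k ^ 2 ^ 2" assume "A \<in> scalar_matrices"
  then obtain c where "c \<noteq> 0" "A = mat c" by (auto simp: scalar_matrices_def)
  moreover from this have "c ^ 4 \<noteq> 0" by simp
  ultimately show "A \<in> form_stabilizer"
    unfolding form_stabilizer_def using invertible_mat tensor_map_mat by blast
qed

text \<open>First isomorphism theorem for \<open>root_perm\<close>: the image consists of all even
  permutations by \<open>form_stabilizer_evenperm\<close>, the kernel of the scalars by
  \<open>permutes_roots_id_iff\<close>.\<close>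

lemma form_stabilizer_Mod_scalars:
  "GL2\<lparr>carrier := form_stabilizer\<rparr> Mod (scalar_matrices :: ('k ^ 2 ^ 2) set) \<cong> alt_group 4"
proof -
  let ?K = "GL2\<lparr>carrier := form_stabilizer\<rparr> :: ('k ^ 2 ^ 2) monoid"
  have "root_perm \<in> hom ?K (alt_group 4)"
  proof (rule homI)
    fix A assume A: "A \<in> carrier ?K"
    then have "permutes_roots A (root_perm A)" by (simp add: permutes_roots_root_perm)
    moreover from this have "root_perm A permutes {1..4}" by (simp only: permutes_roots_def)
    ultimately show "root_perm A \<in> carrier (alt_group 4)"
      using A form_stabilizer_evenperm by (auto simp: alt_group_carrier)
    fix B assume B: "B \<in> carrier ?K"
    have "permutes_roots (A ** B) (root_perm A \<circ> root_perm B)"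
      using A B by (intro permutes_roots_mult permutes_roots_root_perm) auto
    then show "root_perm (A \<otimes>\<^bsub>?K\<^esub> B) = root_perm A \<otimes>\<^bsub>alt_group 4\<^esub> root_perm B"
      by (simp add: GL2_simps alt_group_mult root_perm_eq)
  qed
  then interpret group_hom ?K "alt_group 4" root_perm
    using group.subgroup_imp_group[OF GL2_group form_stabilizer_subgroup] alt_group_is_group
    by (simp add: group_hom_def group_hom_axioms_def)
  have "root_perm ` carrier ?K = carrier (alt_group 4)"
  proof
    show "root_perm ` carrier ?K \<subseteq> carrier (alt_group 4)" by auto
    show "carrier (alt_group 4) \<subseteq> root_perm ` carrier ?K"
    proof
      fix \<pi> assume "\<pi> \<in> carrier (alt_group 4)"
      then obtain A where "A \<in> form_stabilizer" "permutes_roots A \<pi>"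
        using form_stabilizer_evenperm by (auto simp: alt_group_carrier)
      then show "\<pi> \<in> root_perm ` carrier ?K" using root_perm_eq by (auto simp: image_iff)
    qed
  qed
  then have "?K Mod kernel ?K (alt_group 4) root_perm \<cong> alt_group 4" by (rule FactGroup_iso)
  moreover have "kernel ?K (alt_group 4) root_perm = scalar_matrices"
  proof -
    have "root_perm A = id \<longleftrightarrow> A \<in> scalar_matrices" if "A \<in> form_stabilizer" for A
      using permutes_roots_id_iff[OF form_stabilizer_invertible[OF that]]
        permutes_roots_root_perm[OF that] root_perm_eq by metis
    then show ?thesis
      using scalar_matrices_subset_form_stabilizer by (auto simp: kernel_def alt_group_one)
  qed
  ultimately show ?thesis by simp
qed

lemma stabilizer_double_form:
  "PGL2\<lparr>carrier := stabilizer PGL2 PGL2_act (vec.span {bq 4 0 0 1 0 :: 'k tensor4})\<rparr> \<cong> alt_group 4"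
proof -
  let ?t = "bq 4 0 0 1 0 :: 'k tensor4"
  have L: "vec.span {?t} \<in> singular_one_spaces"
    unfolding singular_one_spaces_eq by (intro imageI normal_forms_singular)
  have "vec.span {tensor_map A ?t} = vec.span {?t} \<longleftrightarrow> A \<in> form_stabilizer" if "invertible A" for A
  proof
    assume eq: "vec.span {tensor_map A ?t} = vec.span {?t}"
    have "?t \<noteq> 0" by (simp add: bq_eq_0_iff)
    then obtain c where "c \<noteq> 0" "tensor_map A ?t = c *s ?t" by (rule span_singleton_eqD[OF eq])
    with that show "A \<in> form_stabilizer" unfolding form_stabilizer_def by blast
  next
    assume "A \<in> form_stabilizer"
    then obtain c where "c \<noteq> 0" "tensor_map A ?t = c *s ?t" by (auto simp: form_stabilizer_def)
    then show "vec.span {tensor_map A ?t} = vec.span {?t}" by (simp add: span_scale_eq)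
  qed
  then have "PGL2_act (scalar_matrices #>\<^bsub>GL2\<^esub> A) (vec.span {?t}) = vec.span {?t} \<longleftrightarrow>
      A \<in> form_stabilizer" if "invertible A" for A
    using that by (simp only: PGL2_act_coset[OF L] tensor_map_span)
  then have "stabilizer PGL2 PGL2_act (vec.span {?t}) =
      {scalar_matrices #>\<^bsub>GL2\<^esub> A | A. A \<in> form_stabilizer}"
    using form_stabilizer_invertible unfolding stabilizer_def carrier_PGL2 by blast
  \<comment> \<open>Cosets and their products are the same sets whether formed in \<open>GL2\<close>
    or in \<open>form_stabilizer\<close>, so this is an equality of groups.\<close>
  then have "PGL2\<lparr>carrier := stabilizer PGL2 PGL2_act (vec.span {?t})\<rparr> =
      GL2\<lparr>carrier := form_stabilizer\<rparr> Mod scalar_matrices"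
    by (auto simp: PGL2_def FactGroup_def RCOSETS_def r_coset_def set_mult_def fun_eq_iff)
  then show ?thesis using form_stabilizer_Mod_scalars by simp
qed

end

theorem theorem4p1:
  fixes p :: nat
  assumes "CHAR('k::alg_closed_field) = p" and "p \<ge> 5"
  shows "card (orbits PGL2 (singular_one_spaces :: 'k tensor4 set set) PGL2_act) = 3 \<and>
         (\<exists>!\<Omega> :: 'k tensor4 set set. is_dense_orbit \<Omega>) \<and>
         (\<forall>\<Omega> :: 'k tensor4 set set. is_dense_orbit \<Omega> \<longrightarrow>
            (\<forall>L\<in>\<Omega>. PGL2\<lparr>carrier := stabilizer PGL2 PGL2_act L\<rparr> \<cong> alt_group 4))"
proof -
  have small: "of_nat n \<noteq> (0 :: 'k)" if "0 < n" "n < 5" for n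
    using that assms by (auto simp: of_nat_eq_0_iff_char_dvd dest: dvd_imp_le)
  have two: "(2::'k) \<noteq> 0" and three: "(3::'k) \<noteq> 0" using small[of 2] small[of 3] by simp_all
  \<comment> \<open>A root of X^2 + X + 1 is a primitive cube root of unity, because 3 is
    nonzero.\<close>
  obtain w :: 'k where w: "poly [:1, 1, 1:] w = 0"
    using alg_closed_imp_poly_has_root[of "[:1, 1, 1 :: 'k:]"] by auto
  interpret equianharmonic w
    by unfold_locales (use two three w in \<open>simp_all add: power2_eq_square algebra_simps\<close>)
  interpret group_action "PGL2 :: ('k^2^2) set monoid" singular_one_spaces PGL2_act
    by (rule PGL2_group_action)
  let ?L = "vec.span {bq 4 0 0 1 0 :: 'k tensor4}"
  have L: "?L \<in> singular_one_spaces"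
    unfolding singular_one_spaces_eq by (intro imageI normal_forms_singular)
  have "PGL2\<lparr>carrier := stabilizer PGL2 PGL2_act M\<rparr> \<cong> alt_group 4"
    if M: "M \<in> open_orbit" for M :: "'k tensor4 set"
  proof -
    have "M \<in> singular_one_spaces" using M open_orbit_subset by blast
    \<comment> \<open>Some group element carries \<open>M\<close> to \<open>?L\<close>, so their
      stabilizers are conjugate.\<close>
    moreover have "?L \<in> orbit PGL2 PGL2_act M"
      using orbit_sym[OF L \<open>M \<in> singular_one_spaces\<close>] M unfolding open_orbit_def .
    then obtain C where C: "C \<in> carrier PGL2" "?L = PGL2_act C M" by (auto simp: orbit_def)
    ultimately have "PGL2\<lparr>carrier := stabilizer PGL2 PGL2_act M\<rparr> \<cong>
        PGL2\<lparr>carrier := stabilizer PGL2 PGL2_act ?L\<rparr>"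
      using stabilizer_conj_iso[of M C] by (simp only: C(2))
    then show ?thesis using stabilizer_double_form by (rule iso_trans)
  qed
  then show ?thesis
    using card_PGL2_orbits[OF two three] open_orbit_dense[OF two three] dense_orbit_unique[OF two three]
    by metis
qed

end
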